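(* The Urysohn sphere $\mathbf{S}$ is approximately indivisible (equivalently, the standard action of $\mathrm{iso}(\mathbf{S})$ on $\mathbf{S}$ is oscillation stable).
   Context: The Urysohn sphere $\mathbf{S}$ is the unique (up to isometry) complete separable ultrahomogeneous metric space with distances in $[0,1]$ into which every finite metric space of diameter at most $1$ embeds isometrically (ultrahomogeneous: every isometry between finite subspaces extends to an isometry of the whole space onto itself). For a metric space $X$, $Y\subset X$ and $\varepsilon>0$, let $(Y)_\varepsilon=\{x\in X:\exists y\in Y\ d(x,y)\leqslant\varepsilon\}$. $X$ is $\varepsilon$-indivisible when for every integer $k\geqslant1$ and every $\chi:X\to\{0,\dots,k-1\}$ there are $i<k$ and a subspace $\widetilde X\subset X$ isometric to $X$ with $\widetilde X\subset(\chi^{-1}(\{i\}))_\varepsilon$. $X$ is approximately indivisible when it is $\varepsilon$-indivisible for every $\varepsilon>0$. $\mathrm{iso}(\mathbf{S})$ is the group of isometries of $\mathbf{S}$ onto itself with the topology of pointwise convergence. For a topological group $G$, the left uniformity has as basis the sets $\{(x,y):x^{-1}y\in V\}$, $V$ a neighborhood of the identity; $\widehat{G}^L$ is the completion of $G$ for this uniformity, which is a topological semigroup. A uniformly continuous $f:G\to\mathbb{R}$, with unique uniformly continuous extension $\hat f$ to $\widehat G^L$, is oscillation stable when for every $\varepsilon>0$ there is a (nonempty) right ideal $\mathcal{I}\subset\widehat G^L$ such that $\sup\{|\hat f(a)-\hat f(b)|:a,b\in\mathcal{I}\}<\varepsilon$. A continuous action of $G$ on a topological space $X$ is oscillation stable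 when for every bounded continuous $f:X\to\mathbb{R}$ and every $x\in X$, the map $f_x:G\to\mathbb{R}$, $f_x(g)=f(gx)$, is oscillation stable whenever it is uniformly continuous. *)

theory Defs
  imports "HOL-Analysis.Analysis" "HOL-Algebra.Group_Action"
begin

section \<open>Isometries and the Urysohn sphere\<close>

definition isometric_embedding ::
  "'a set \<Rightarrow> ('a \<Rightarrow> 'a \<Rightarrow> real) \<Rightarrow> 'b set \<Rightarrow> ('b \<Rightarrow> 'b \<Rightarrow> real) \<Rightarrow> ('a \<Rightarrow> 'b) \<Rightarrow> bool" where
  "isometric_embedding M d M' d' f \<longleftrightarrow>
     f \<in> M \<rightarrow> M' \<and> (\<forall>x\<in>M. \<forall>y\<in>M. d' (f x) (f y) = d x y)"

definition isometry_onto ::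
  "'a set \<Rightarrow> ('a \<Rightarrow> 'a \<Rightarrow> real) \<Rightarrow> 'b set \<Rightarrow> ('b \<Rightarrow> 'b \<Rightarrow> real) \<Rightarrow> ('a \<Rightarrow> 'b) \<Rightarrow> bool" where
  "isometry_onto M d M' d' f \<longleftrightarrow> isometric_embedding M d M' d' f \<and> f ` M = M'"

definition isometric ::
  "'a set \<Rightarrow> ('a \<Rightarrow> 'a \<Rightarrow> real) \<Rightarrow> 'b set \<Rightarrow> ('b \<Rightarrow> 'b \<Rightarrow> real) \<Rightarrow> bool" where
  "isometric M d M' d' \<longleftrightarrow> (\<exists>f. isometry_onto M d M' d' f)"

definition ultrahomogeneous :: "'a set \<Rightarrow> ('a \<Rightarrow> 'a \<Rightarrow> real) \<Rightarrow> bool" where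
  "ultrahomogeneous M d \<longleftrightarrow>
     (\<forall>A B f. finite A \<and> A \<subseteq> M \<and> finite B \<and> B \<subseteq> M \<and> isometry_onto A d B d f \<longrightarrow>
        (\<exists>g. isometry_onto M d M d g \<and> (\<forall>x\<in>A. g x = f x)))"

text \<open>Every finite metric space is isometric to one whose points are natural numbers, so
  it suffices to quantify over the latter. The space is determined up to isometry by the
  following predicate.\<close>

definition urysohn_sphere :: "'a set \<Rightarrow> ('a \<Rightarrow> 'a \<Rightarrow> real) \<Rightarrow> bool" where
  "urysohn_sphere M d \<longleftrightarrow>
     Metric_space M d \<and>
     Metric_space.mcomplete M d \<and>
     separable_space (Metric_space.mtopology M d) \<and>
     ultrahomogeneous M d \<and>
     (\<forall>x\<in>M. \<forall>y\<in>M. d x y \<in> {0..1}) \<and>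
     (\<forall>(F :: nat set) \<rho>. finite F \<and> Metric_space F \<rho> \<and> (\<forall>x\<in>F. \<forall>y\<in>F. \<rho> x y \<le> 1) \<longrightarrow>
        (\<exists>f. isometric_embedding F \<rho> M d f))"


section \<open>Approximate indivisibility\<close>

definition thickening :: "'a set \<Rightarrow> ('a \<Rightarrow> 'a \<Rightarrow> real) \<Rightarrow> real \<Rightarrow> 'a set \<Rightarrow> 'a set" where
  "thickening M d \<epsilon> Y = {x \<in> M. \<exists>y\<in>Y. d x y \<le> \<epsilon>}"

definition eps_indivisible :: "'a set \<Rightarrow> ('a \<Rightarrow> 'a \<Rightarrow> real) \<Rightarrow> real \<Rightarrow> bool" where
  "eps_indivisible M d \<epsilon> \<longleftrightarrow>
     (\<forall>(k::nat) c. k \<ge> 1 \<and> c \<in> M \<rightarrow> {..<k} \<longrightarrow>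
        (\<exists>i<k. \<exists>N\<subseteq>M. isometric M d N d \<and> N \<subseteq> thickening M d \<epsilon> {x\<in>M. c x = i}))"

definition approximately_indivisible :: "'a set \<Rightarrow> ('a \<Rightarrow> 'a \<Rightarrow> real) \<Rightarrow> bool" where
  "approximately_indivisible M d \<longleftrightarrow> (\<forall>\<epsilon>>0. eps_indivisible M d \<epsilon>)"


section \<open>Completion of a uniformity on a set\<close>

text \<open>As in the class \<^class>\<open>uniform_space\<close>, a uniformity is a filter on pairs; here it lives on an
  explicit carrier \<open>X\<close>. The points of the (Hausdorff) completion are the minimal Cauchy filters.
  The order on the type of filters is opposite to inclusion of the families of large sets, so
  the minimal ones are the maximal elements for \<open>\<le>\<close>.\<close>

definition cauchy_filter_in :: "'g set \<Rightarrow> ('g \<times> 'g) filter \<Rightarrow> 'g filter \<Rightarrow> bool" where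
  "cauchy_filter_in X U F \<longleftrightarrow> F \<noteq> bot \<and> F \<le> principal X \<and> F \<times>\<^sub>F F \<le> U"

definition completion :: "'g set \<Rightarrow> ('g \<times> 'g) filter \<Rightarrow> 'g filter set" where
  "completion X U =
     {F. cauchy_filter_in X U F \<and> (\<forall>F'. cauchy_filter_in X U F' \<and> F \<le> F' \<longrightarrow> F' = F)}"

definition completion_uniformity ::
  "'g set \<Rightarrow> ('g \<times> 'g) filter \<Rightarrow> ('g filter \<times> 'g filter) filter" where
  "completion_uniformity X U =
     (INF P\<in>{P. eventually P U}.
        principal {(F, F') \<in> completion X U \<times> completion X U. eventually P (F \<times>\<^sub>F F')})"

text \<open>The canonical map into the completion sends a point to its neighbourhood filter.\<close>

definition completion_embed :: "('g \<times> 'g) filter \<Rightarrow> 'g \<Rightarrow> 'g filter" where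
  "completion_embed U x = filtercomap (Pair x) U"

text \<open>The limit in the completion of a Cauchy filter on \<open>X\<close>.\<close>

definition completion_lim :: "'g set \<Rightarrow> ('g \<times> 'g) filter \<Rightarrow> 'g filter \<Rightarrow> 'g filter" where
  "completion_lim X U F = (THE H. H \<in> completion X U \<and> F \<le> H)"

definition uniformly_continuous_wrt ::
  "('g \<times> 'g) filter \<Rightarrow> ('g \<Rightarrow> 'b::uniform_space) \<Rightarrow> bool" where
  "uniformly_continuous_wrt U f \<longleftrightarrow> filterlim (\<lambda>(x, y). (f x, f y)) uniformity U"


section \<open>Topological groups, left completion, oscillation stability\<close>

definition topological_group :: "('g, 'm) monoid_scheme \<Rightarrow> 'g topology \<Rightarrow> bool" where
  "topological_group G T \<longleftrightarrow>
     group G \<and> topspace T = carrier G \<and>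
     continuous_map (prod_topology T T) T (\<lambda>(x, y). x \<otimes>\<^bsub>G\<^esub> y) \<and>
     continuous_map T T (\<lambda>x. inv\<^bsub>G\<^esub> x)"

definition continuous_action ::
  "('g, 'm) monoid_scheme \<Rightarrow> 'g topology \<Rightarrow> 'x topology \<Rightarrow> ('g \<Rightarrow> 'x \<Rightarrow> 'x) \<Rightarrow> bool" where
  "continuous_action G T X \<phi> \<longleftrightarrow>
     group_action G (topspace X) \<phi> \<and>
     continuous_map (prod_topology T X) X (\<lambda>(g, x). \<phi> g x)"

definition left_uniformity ::
  "('g, 'm) monoid_scheme \<Rightarrow> 'g topology \<Rightarrow> ('g \<times> 'g) filter" where
  "left_uniformity G T =
     inf (filtercomap (\<lambda>(x, y). inv\<^bsub>G\<^esub> x \<otimes>\<^bsub>G\<^esub> y) (nhdsin T \<one>\<^bsub>G\<^esub>))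
         (principal (carrier G \<times> carrier G))"

definition left_completion :: "('g, 'm) monoid_scheme \<Rightarrow> 'g topology \<Rightarrow> 'g filter set" where
  "left_completion G T = completion (carrier G) (left_uniformity G T)"

text \<open>The multiplication of the semigroup is the extension by continuity of that of \<open>G\<close>: the
  product of \<open>a\<close> and \<open>b\<close> is the limit of \<open>x \<otimes> y\<close> as \<open>x\<close> runs along \<open>a\<close> and \<open>y\<close> along \<open>b\<close>.\<close>

definition left_completion_mult ::
  "('g, 'm) monoid_scheme \<Rightarrow> 'g topology \<Rightarrow> 'g filter \<Rightarrow> 'g filter \<Rightarrow> 'g filter" where
  "left_completion_mult G T a b =
     completion_lim (carrier G) (left_uniformity G T)
       (filtermap (\<lambda>(x, y). x \<otimes>\<^bsub>G\<^esub> y) (a \<times>\<^sub>F b))"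

definition right_ideal_left_completion ::
  "('g, 'm) monoid_scheme \<Rightarrow> 'g topology \<Rightarrow> 'g filter set \<Rightarrow> bool" where
  "right_ideal_left_completion G T I \<longleftrightarrow>
     I \<noteq> {} \<and> I \<subseteq> left_completion G T \<and>
     (\<forall>a\<in>I. \<forall>b\<in>left_completion G T. left_completion_mult G T a b \<in> I)"

text \<open>\<open>h\<close> is the uniformly continuous extension of \<open>f\<close>. The supremum is taken in the extended
  reals, where it is meaningful without assuming boundedness.\<close>

definition oscillation_stable ::
  "('g, 'm) monoid_scheme \<Rightarrow> 'g topology \<Rightarrow> ('g \<Rightarrow> real) \<Rightarrow> bool" where
  "oscillation_stable G T f \<longleftrightarrow>
     uniformly_continuous_wrt (left_uniformity G T) f \<and>
     (\<exists>h. uniformly_continuous_wrt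
            (completion_uniformity (carrier G) (left_uniformity G T)) h \<and>
          (\<forall>g\<in>carrier G. h (completion_embed (left_uniformity G T) g) = f g) \<and>
          (\<forall>\<epsilon>>0. \<exists>I. right_ideal_left_completion G T I \<and>
             (SUP (a, b)\<in>I \<times> I. ereal \<bar>h a - h b\<bar>) < ereal \<epsilon>))"

definition oscillation_stable_action ::
  "('g, 'm) monoid_scheme \<Rightarrow> 'g topology \<Rightarrow> 'x topology \<Rightarrow> ('g \<Rightarrow> 'x \<Rightarrow> 'x) \<Rightarrow> bool" where
  "oscillation_stable_action G T X \<phi> \<longleftrightarrow>
     topological_group G T \<and> continuous_action G T X \<phi> \<and>
     (\<forall>f. continuous_map X euclideanreal f \<and> bounded (f ` topspace X) \<longrightarrow>
        (\<forall>x\<in>topspace X.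
           uniformly_continuous_wrt (left_uniformity G T) (\<lambda>g. f (\<phi> g x)) \<longrightarrow>
           oscillation_stable G T (\<lambda>g. f (\<phi> g x))))"


section \<open>The isometry group and its standard action\<close>

text \<open>Following \<^const>\<open>Bij\<close>, isometries are extensional functions, so that equality of
  group elements is equality of maps on \<open>M\<close>.\<close>

definition iso_set :: "'a set \<Rightarrow> ('a \<Rightarrow> 'a \<Rightarrow> real) \<Rightarrow> ('a \<Rightarrow> 'a) set" where
  "iso_set M d = {g \<in> extensional M. isometry_onto M d M d g}"

definition iso_group :: "'a set \<Rightarrow> ('a \<Rightarrow> 'a \<Rightarrow> real) \<Rightarrow> ('a \<Rightarrow> 'a) monoid" where
  "iso_group M d = BijGroup M \<lparr>carrier := iso_set M d\<rparr>"

definition iso_topology :: "'a set \<Rightarrow> ('a \<Rightarrow> 'a \<Rightarrow> real) \<Rightarrow> ('a \<Rightarrow> 'a) topology" where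
  "iso_topology M d =
     subtopology (product_topology (\<lambda>_. Metric_space.mtopology M d) M) (iso_set M d)"

end

theory Submission
  imports Defs
begin

text \<open>The combinatorial core is a Gowers-type theorem for words: for every finite colouring of the
  words over \<open>{0..K}\<close> there are words \<open>b 0, b 1, \<dots>\<close> containing the letter 0 such that all words
  \<open>(b 0 + e 0) @ \<dots> @ (b (n - 1) + e (n - 1)) @ b n\<close> with \<open>e j \<le> K\<close> have the same colour, where
  \<open>+\<close> is addition to each letter, truncated at \<open>K\<close>. As in Gowers' proof of the \<open>FIN\<^sub>k\<close> theorem
  the words come from idempotent ultrafilters.

  A word scaled by \<open>1 / K\<close> is read as a list of distances to an imaginary sequence of points; it
  contains 0, so that it names a point itself. Comparing two such lists on their common length
  gives the edge weights of a graph, hence a path pseudometric on the lists containing 0 with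
  entries in a countable set of distances; this countable space embeds into the Urysohn sphere and pulls the colouring back to
  words. If \<open>y\<close> is a dense sequence, the lists obtained from \<open>b\<close> with shifts \<open>d (y n) (y j)\<close> form an
  isometric copy of \<open>y\<close>, and rounding the shifts to multiples of \<open>1 / K\<close> moves them by at most
  \<open>1 / K\<close>, into a monochromatic set. By completeness the copy of \<open>y\<close> extends to a copy of the
  sphere.

  For the action, the points of the left completion are the neighbourhood filters of isometric
  self-embeddings, multiplied by composition. A copy on which the function oscillates little
  yields the right ideal of all embeddings into that copy.\<close>

section \<open>Ultrafilters on words\<close>

text \<open>Word \<open>n\<close> stands for \<open>y n\<close>: block \<open>j < n\<close> is
  shifted by the distance from \<open>y n\<close> to \<open>y j\<close>, and the last block is
  unshifted. Lists \<open>m < n\<close> share the positions of blocks \<open>0..m\<close>, where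
  entries from block \<open>j\<close> differ by at most the difference of the distances of
  \<open>y m\<close> and \<open>y n\<close> to \<open>y j\<close>, hence by at most the distance
  from \<open>y m\<close> to \<open>y n\<close>; at a zero of block \<open>m\<close> they differ by
  exactly that. The obstacle is that comparison on a common initial part is not transitive, so a
  detour through a short list might be cheap. The zeros prevent this: a path of length
  \<open>l\<close> leaves a common position whose two entries sum to at most \<open>l\<close>, and
  for lists \<open>m\<close> and \<open>n\<close> such a sum is at least the distance to be
  preserved.

  The shifts that a block will undergo are unknown when it is chosen and vary with the later words,
  so the ultrafilter has to absorb all its raised copies at once. The colouring theorem offers only
  finitely many shifts, while an isometric copy needs exact distances; lists of both kinds therefore
  live in one space, the exact ones forming the copy and the rounded ones carrying the
  colour.\<close>

lemma ellis_numakura: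
  fixes S :: "'a::topological_space set" and f :: "'a \<Rightarrow> 'a \<Rightarrow> 'a"
  assumes haus: "Hausdorff_space (euclidean :: 'a topology)" and "compact S" "S \<noteq> {}"
    and closed: "\<And>x y. x \<in> S \<Longrightarrow> y \<in> S \<Longrightarrow> f x y \<in> S"
    and assoc: "\<And>x y z. x \<in> S \<Longrightarrow> y \<in> S \<Longrightarrow> z \<in> S \<Longrightarrow> f (f x y) z = f x (f y z)"
    and cont: "\<And>y. y \<in> S \<Longrightarrow> continuous_on S (\<lambda>x. f x y)"
  obtains e where "e \<in> S" "f e e = e"
proof -
  have compact_closed: "closed M" if "compact M" for M :: "'a set"
    using compactin_imp_closedin[OF haus] that by simp
  \<comment> \<open>Zorn gives a minimal nonempty compact subsemigroup; each of its elements turns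
    out to be idempotent.\<close>
  define A where "A = {M. M \<subseteq> S \<and> compact M \<and> M \<noteq> {} \<and> (\<forall>x\<in>M. \<forall>y\<in>M. f x y \<in> M)}"
  have "\<exists>M\<in>A. \<forall>N\<in>A. M \<supseteq> N \<longrightarrow> N = M"
  proof (rule predicate_Zorn)
    show "partial_order_on A (relation_of (\<supseteq>) A)"
      by (auto simp: partial_order_on_def preorder_on_def refl_on_def trans_def antisym_def relation_of_def)
    fix C assume C: "C \<in> Chains (relation_of (\<supseteq>) A)"
    have lin: "M \<subseteq> N \<or> N \<subseteq> M" if "M \<in> C" "N \<in> C" for M N
      using C that by (auto simp: Chains_def relation_of_def)
    show "\<exists>u\<in>A. \<forall>a\<in>C. u \<subseteq> a"
    proof (cases "C = {}")
      case True
      have "S \<in> A" using assms by (auto simp: A_def)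
      then show ?thesis using True by blast
    next
      case False
      then obtain M0 where M0: "M0 \<in> C" by blast
      have cA: "M \<in> A" if "M \<in> C" for M using C that by (auto simp: Chains_def relation_of_def)
      have cc: "compact M" if "M \<in> C" for M using cA[OF that] by (auto simp: A_def)
      have clo: "closed M" if "M \<in> C" for M using cc[OF that] by (rule compact_closed)
      have "M0 \<inter> \<Inter>C \<noteq> {}"
      proof (rule compact_imp_fip[OF cc[OF M0]])
        show "closed T" if "T \<in> C" for T using clo[OF that] .
        fix F' assume F': "finite F'" "F' \<subseteq> C"
        have "\<exists>N\<in>C. N \<subseteq> M0 \<inter> \<Inter>F'"
          using F'
        proof (induction F' rule: finite_induct)
          case empty then show ?case using M0 by auto
        next
          case (insert x F)
          then obtain N where N: "N \<in> C" "N \<subseteq> M0 \<inter> \<Inter>F" by (metis insert_subset)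
          have "x \<in> C" using insert.prems by simp
          from lin[OF N(1) this] show ?case
          proof
            assume "N \<subseteq> x" then show ?thesis using N by (intro bexI[of _ N]) simp_all
          next
            assume "x \<subseteq> N"
            then have "x \<subseteq> M0 \<inter> \<Inter>F" using N(2) by (rule order_trans)
            then have "x \<subseteq> M0 \<inter> \<Inter>(insert x F)" by simp
            then show ?thesis using \<open>x \<in> C\<close> by blast
          qed
        qed
        then show "M0 \<inter> \<Inter>F' \<noteq> {}" using cA unfolding A_def by blast
      qed
      moreover have "compact (M0 \<inter> \<Inter>C)"
        by (intro compact_Int_closed cc M0 closed_Inter ballI clo)
      moreover have "M0 \<inter> \<Inter>C = \<Inter>C" using M0 by blast
      ultimately have "\<Inter>C \<in> A"
        using cA M0 unfolding A_def by fastforce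
      then show ?thesis by blast
    qed
  qed
  then obtain M where MA: "M \<in> A" and min: "\<And>N. N \<in> A \<Longrightarrow> N \<subseteq> M \<Longrightarrow> N = M" by blast
  have MS: "M \<subseteq> S" and Mc: "compact M" and Mn: "M \<noteq> {}"
    and Mf: "\<And>x y. x \<in> M \<Longrightarrow> y \<in> M \<Longrightarrow> f x y \<in> M" using MA by (auto simp: A_def)
  obtain q where q: "q \<in> M" using Mn by blast
  have contq: "continuous_on M (\<lambda>x. f x q)"
    using cont[of q] q MS continuous_on_subset by blast
  have "(\<lambda>x. f x q) ` M \<in> A"
  proof -
    have "f (f x q) (f y q) = f (f (f x q) y) q" if "x \<in> M" "y \<in> M" for x y
      using assoc[of "f x q" y q] subsetD[OF MS] that q Mf by metis
    then have "f (f x q) (f y q) \<in> (\<lambda>x. f x q) ` M" if "x \<in> M" "y \<in> M" for x y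
      using that q Mf by auto
    then show ?thesis
      using compact_continuous_image[OF contq Mc] Mn Mf[OF _ q] MS unfolding A_def by blast
  qed
  then have "(\<lambda>x. f x q) ` M = M" using Mf q by (intro min) auto
  then obtain p where p: "p \<in> M" "f p q = q" using q by (metis (no_types, lifting) imageE)
  \<comment> \<open>The elements fixing \<open>q\<close> from the left form a compact subsemigroup,
    nonempty because of \<open>p\<close>; by minimality it contains \<open>q\<close> itself.\<close>
  define N where "N = {x \<in> M. f x q = q}"
  have "N \<in> A"
  proof -
    have "closed N"
      unfolding N_def using continuous_closed_preimage[OF contq compact_closed[OF Mc], of "{q}"] compact_closed[of "{q}"]
      by (simp add: vimage_def Int_def)
    then have "compact N" using Mc unfolding N_def
      by (metis (no_types, lifting) compact_Int_closed inf.absorb_iff2 mem_Collect_eq subsetI)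
    moreover have "f x y \<in> N" if "x \<in> N" "y \<in> N" for x y
      using that assoc[of x y q] subsetD[OF MS] q Mf unfolding N_def mem_Collect_eq by metis
    ultimately show ?thesis using p MS by (auto simp: A_def N_def)
  qed
  then have "N = M" by (rule min) (auto simp: N_def)
  then have "f q q = q" using q by (auto simp: N_def)
  then show thesis using that q MS by blast
qed

text \<open>An ultrafilter is encoded as its membership predicate, so that the topology of the space of
  ultrafilters is that of a product of copies of \<^typ>\<open>bool\<close>.\<close>

definition ultra :: "('w set \<Rightarrow> bool) \<Rightarrow> bool" where
  "ultra p \<longleftrightarrow> p UNIV \<and> (\<forall>A B. p (A \<inter> B) = (p A \<and> p B)) \<and> (\<forall>A. p (- A) = (\<not> p A))"

text \<open>The direct image of an ultrafilter.\<close>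

definition push :: "('v \<Rightarrow> 'w) \<Rightarrow> ('v set \<Rightarrow> bool) \<Rightarrow> 'w set \<Rightarrow> bool" where
  "push g p A \<longleftrightarrow> p (g -` A)"

text \<open>The product on the Stone-Cech compactification of the semigroup of words: an iterated
  limit, the inner one along \<open>q\<close>. This order makes it continuous in
  \<open>p\<close>.\<close>

definition uconc :: "('l list set \<Rightarrow> bool) \<Rightarrow> ('l list set \<Rightarrow> bool) \<Rightarrow> 'l list set \<Rightarrow> bool" where
  "uconc p q A \<longleftrightarrow> p {x. q {y. x @ y \<in> A}}"

lemma compact_UNIV_set_to_bool: "compact (UNIV :: ('w set \<Rightarrow> bool) set)"
proof -
  have "compact (UNIV :: bool set)" by (rule finite_imp_compact) simp
  then have "compact_space (euclidean :: bool topology)"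
    unfolding compact_space_def topspace_euclidean compactin_euclidean_iff .
  then have "compact_space (product_topology (\<lambda>_::'w set. euclidean :: bool topology) UNIV)"
    unfolding compact_space_product_topology by blast
  then show ?thesis
    unfolding compact_space_def euclidean_product_topology topspace_euclidean compactin_euclidean_iff .
qed

lemma Hausdorff_set_to_bool: "Hausdorff_space (euclidean :: ('w set \<Rightarrow> bool) topology)"
proof -
  have "Hausdorff_space (euclidean :: bool topology)"
    unfolding Hausdorff_space_def
  proof (intro allI impI)
    fix x y :: bool assume "x \<in> topspace euclidean \<and> y \<in> topspace euclidean \<and> x \<noteq> y"
    then show "\<exists>U V. openin euclidean U \<and> openin euclidean V \<and> x \<in> U \<and> y \<in> V \<and> disjnt U V"
      by (intro exI[of _ "{x}"] exI[of _ "{y}"]) (simp add: open_discrete)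
  qed
  then show ?thesis
    unfolding euclidean_product_topology[symmetric] Hausdorff_space_product_topology by blast
qed

lemma clopen_coordinate: "closed {p :: 'w set \<Rightarrow> bool. p A}" "open {p :: 'w set \<Rightarrow> bool. p A}"
proof -
  have c: "continuous_on UNIV (\<lambda>p :: 'w set \<Rightarrow> bool. p A)"
    by (rule continuous_on_product_coordinates)
  have eq: "(\<lambda>p. p A) -` {True} = {p :: 'w set \<Rightarrow> bool. p A}" by (simp only: vimage_def singleton_iff eq_True)
  show "closed {p :: 'w set \<Rightarrow> bool. p A}"
    using closed_vimage[OF finite_imp_closed c, of "{True}"] unfolding eq by simp
  show "open {p :: 'w set \<Rightarrow> bool. p A}"
    using open_vimage[OF open_discrete c, of "{True}"] unfolding eq .
qed

lemma closed_ultra: "closed {p :: 'w set \<Rightarrow> bool. ultra p}"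
proof -
  have 1: "closed {p :: 'w set \<Rightarrow> bool. p (A \<inter> B) = (p A \<and> p B)}" for A B
  proof -
    have "{p :: 'w set \<Rightarrow> bool. p (A \<inter> B) = (p A \<and> p B)} =
      ({p. p (A \<inter> B)} \<inter> {p. p A} \<inter> {p. p B}) \<union> (- {p. p (A \<inter> B)} \<inter> (- {p. p A} \<union> - {p. p B}))"
      by auto
    then show ?thesis
      by (simp only:) (intro closed_Un closed_Int closed_Compl clopen_coordinate)
  qed
  have 2: "closed {p :: 'w set \<Rightarrow> bool. p (- A) = (\<not> p A)}" for A
  proof -
    have "{p :: 'w set \<Rightarrow> bool. p (- A) = (\<not> p A)} =
      ({p. p (- A)} \<inter> - {p. p A}) \<union> (- {p. p (- A)} \<inter> {p. p A})"
      by auto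
    then show ?thesis
      by (simp only:) (intro closed_Un closed_Int closed_Compl clopen_coordinate)
  qed
  show ?thesis unfolding ultra_def
    by (intro closed_Collect_conj closed_Collect_all clopen_coordinate 1 2)
qed

lemma
  assumes "ultra p"
  shows ultra_UNIV: "p UNIV"
    and ultra_Int: "p (A \<inter> B) \<longleftrightarrow> p A \<and> p B"
    and ultra_Compl: "p (- A) \<longleftrightarrow> \<not> p A"
proof -
  note * = assms[unfolded ultra_def]
  show "p UNIV" by (rule *[THEN conjunct1])
  show "p (A \<inter> B) \<longleftrightarrow> p A \<and> p B" by (rule *[THEN conjunct2, THEN conjunct1, rule_format])
  show "p (- A) \<longleftrightarrow> \<not> p A" by (rule *[THEN conjunct2, THEN conjunct2, rule_format])
qed

lemma ultra_mono:
  assumes "ultra p" "p A" "A \<subseteq> B"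
  shows "p B"
proof -
  have "A \<inter> B = A" using assms(3) by blast
  then show ?thesis using ultra_Int[OF assms(1), of A B] assms(2) by simp
qed

lemma ultra_INT:
  assumes "ultra p" "finite I" "\<And>i. i \<in> I \<Longrightarrow> p (A i)"
  shows "p (\<Inter>i\<in>I. A i)"
  using assms(2,3)
proof (induction I rule: finite_induct)
  case empty
  then show ?case using ultra_UNIV[OF assms(1)] by simp
next
  case (insert x F)
  then show ?case using ultra_Int[OF assms(1), of "A x" "\<Inter>i\<in>F. A i"] by simp
qed

lemma ultra_nonempty:
  assumes "ultra p" "p A"
  shows "A \<noteq> {}"
proof
  assume "A = {}"
  then have "p (- UNIV)" using assms(2) by simp
  then show False using ultra_Compl[OF assms(1)] ultra_UNIV[OF assms(1)] by blast
qed

lemma ultra_cong_on: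
  assumes "ultra p" "p B" "A \<inter> B = A' \<inter> B"
  shows "p A = p A'"
  using ultra_Int[OF assms(1), of A B] ultra_Int[OF assms(1), of A' B] assms by simp

lemma ultra_colour:
  fixes c :: "'w \<Rightarrow> nat"
  assumes "ultra p" "\<And>w. c w < r"
  obtains i where "p {w. c w = i}"
proof (rule ccontr)
  assume "\<not> thesis"
  then have "\<not> p {w. c w = i}" for i using that by blast
  then have "p (- {w. c w = i})" for i using ultra_Compl[OF assms(1)] by blast
  then have "p (\<Inter>i\<in>{..<r}. - {w. c w = i})" by (rule ultra_INT[OF assms(1) finite_lessThan])
  moreover have "(\<Inter>i\<in>{..<r}. - {w. c w = i}) = {}" using assms(2) by auto
  ultimately show False using ultra_nonempty[OF assms(1)] by blast
qed

lemma ultra_push: "ultra p \<Longrightarrow> ultra (push g p)"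
  unfolding ultra_def push_def vimage_Compl vimage_Int vimage_UNIV by blast

lemma ultra_uconc:
  assumes p: "ultra p" and q: "ultra q"
  shows "ultra (uconc p q)"
proof -
  have 0: "{y. x @ y \<in> UNIV} = UNIV" for x :: "'a list" by simp
  have 1: "{y. x @ y \<in> - A} = - {y. x @ y \<in> A}" for x :: "'a list" and A by auto
  have 2: "{y. x @ y \<in> A \<inter> B} = {y. x @ y \<in> A} \<inter> {y. x @ y \<in> B}" for x :: "'a list" and A B by auto
  have 3: "{x. \<not> q {y. x @ y \<in> A}} = - {x. q {y. x @ y \<in> A}}" for A by auto
  have 4: "{x. q {y. x @ y \<in> A} \<and> q {y. x @ y \<in> B}} = {x. q {y. x @ y \<in> A}} \<inter> {x. q {y. x @ y \<in> B}}"
    for A B by auto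
  show ?thesis
    unfolding ultra_def uconc_def 0 1 2 ultra_Int[OF q] ultra_Compl[OF q] 3 4 ultra_Int[OF p] ultra_Compl[OF p]
    by (simp add: ultra_UNIV[OF p] ultra_UNIV[OF q])
qed

lemma uconc_assoc: "uconc (uconc p q) r = uconc p (uconc q r)"
  unfolding uconc_def fun_eq_iff mem_Collect_eq append_assoc by blast

lemma push_uconc:
  assumes "\<And>x y. g (x @ y) = g x @ g y"
  shows "push g (uconc p q) = uconc (push g p) (push g q)"
  unfolding uconc_def push_def fun_eq_iff vimage_def mem_Collect_eq assms by blast

lemma push_push: "push g (push h p) = push (g \<circ> h) p"
  unfolding push_def fun_eq_iff vimage_comp by blast

lemma push_id: "push id p = p"
  by (simp add: push_def fun_eq_iff)

text \<open>Only the left factor may vary: \<^const>\<open>uconc\<close> is not continuous in its right argument.\<close>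

lemma continuous_on_uconc: "continuous_on S (\<lambda>p. uconc p q)"
  unfolding uconc_def by (intro continuous_on_coordinatewise_then_product)
    (auto intro: continuous_on_subset[OF continuous_on_product_coordinates])

lemma uconc_conc:
  assumes "ultra p" "ultra q" "p A" "q B" "\<And>x y. x \<in> A \<Longrightarrow> y \<in> B \<Longrightarrow> x @ y \<in> C"
  shows "uconc p q C"
proof -
  have "q {y. x @ y \<in> C}" if "x \<in> A" for x
    using ultra_mono[OF assms(2,4), of "{y. x @ y \<in> C}"] assms(5)[OF that] by blast
  then have "A \<subseteq> {x. q {y. x @ y \<in> C}}" by blast
  then show ?thesis unfolding uconc_def using ultra_mono[OF assms(1,3)] by blast
qed

section \<open>A Gowers-type theorem for words\<close>

definition raise :: "nat \<Rightarrow> nat list \<Rightarrow> nat list" where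
  "raise K = map (\<lambda>a. min K (Suc a))"

text \<open>The least letter is exactly \<open>j\<close>. For \<open>j < K\<close>,
  \<open>raise K\<close> carries level \<open>j\<close> into level \<open>Suc j\<close>, and level 0
  consists of the words that name a point.\<close>

definition level :: "nat \<Rightarrow> nat \<Rightarrow> nat list set" where
  "level K j = {w. j \<in> set w \<and> set w \<subseteq> {j..K}}"

text \<open>Absorption of all raised copies on the left is what the colouring theorem uses; the case
  \<open>e = 0\<close> is idempotence. The last equation drives the descent: it keeps the lifts of
  \<open>V\<close> one level down stable under multiplication by \<open>V\<close> on the
  right.\<close>

definition absorbing :: "nat \<Rightarrow> nat \<Rightarrow> (nat list set \<Rightarrow> bool) \<Rightarrow> bool" where
  "absorbing K j V \<longleftrightarrow> ultra V \<and> V (level K j) \<and> (\<forall>e. uconc (push (raise K ^^ e) V) V = V)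
     \<and> uconc V (push (raise K) V) = V"

lemma raise_append: "raise K (x @ y) = raise K x @ raise K y"
  by (simp add: raise_def)

lemma funpow_raise:
  assumes "set w \<subseteq> {..K}"
  shows "(raise K ^^ e) w = map (\<lambda>a. min K (a + e)) w"
proof (induction e)
  case 0
  have "map (\<lambda>a. min K (a + 0)) w = map id w"
    using assms by (intro map_cong) auto
  then show ?case by simp
next
  case (Suc e)
  then show ?case by (simp add: raise_def min_def)
qed

lemma level_append1: "x \<in> level K j \<Longrightarrow> y \<in> level K j \<Longrightarrow> x @ y \<in> level K j"
  by (auto simp: level_def)

lemma level_append2: "x \<in> level K j \<Longrightarrow> y \<in> level K (Suc j) \<Longrightarrow> x @ y \<in> level K j"
  by (force simp: level_def)

lemma level_append3: "x \<in> level K (Suc j) \<Longrightarrow> y \<in> level K j \<Longrightarrow> x @ y \<in> level K j"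
  by (force simp: level_def)

text \<open>On level \<open>K\<close> only words with all letters equal to \<open>K\<close> remain,
  and \<open>raise K\<close> fixes them; so any idempotent concentrated there will do.\<close>

lemma absorbing_top: "\<exists>V. absorbing K K V"
proof -
  define S where "S = {X. ultra X \<and> X (level K K)}"
  have "closed S" unfolding S_def by (intro closed_Collect_conj closed_ultra clopen_coordinate)
  then have cS: "compact S" using compact_Int_closed[OF compact_UNIV_set_to_bool] by fastforce
  have ne: "(\<lambda>A. [K] \<in> A) \<in> S" by (auto simp: S_def ultra_def level_def)
  obtain V where V: "V \<in> S" "uconc V V = V"
  proof (rule ellis_numakura[where f = uconc, OF Hausdorff_set_to_bool cS])
    show "S \<noteq> {}" using ne by blast
    show "uconc x y \<in> S" if "x \<in> S" "y \<in> S" for x y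
      using that ultra_uconc[of x y] uconc_conc[of x y "level K K" "level K K" "level K K"] level_append1
      unfolding S_def mem_Collect_eq by metis
  qed (auto simp: uconc_assoc continuous_on_uconc)
  have u: "ultra V" "V (level K K)" using V by (simp_all add: S_def)
  have "raise K w = w" if "w \<in> level K K" for w
    using that by (force simp: level_def raise_def intro!: map_idI)
  then have "(raise K -` A) \<inter> level K K = A \<inter> level K K" for A
    by auto
  then have 1: "push (raise K) V = V"
    unfolding push_def by (intro ext ultra_cong_on[OF u])
  have "push (raise K ^^ e) V = V" for e
  proof (induction e)
    case 0
    show ?case by (simp add: push_def)
  next
    case (Suc e)
    then show ?case unfolding funpow.simps push_push[symmetric] using 1 by (simp only:)
  qed
  then have "absorbing K K V" using u V 1 by (simp add: absorbing_def)
  then show ?thesis by blast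
qed

text \<open>The ultrafilters \<open>X\<close> one level down that are pushed to \<open>V\<close> form a compact semigroup, and so do
  their products \<open>X V\<close>; an idempotent \<open>E\<close> of the latter satisfies \<open>E V = E\<close>, and \<open>V E\<close> is then
  absorbed by \<open>V\<close> on both sides.\<close>

lemma absorbing_step:
  assumes "absorbing K (Suc j) V" "Suc j \<le> K"
  shows "\<exists>W. absorbing K j W"
proof -
  have u: "ultra V" and lV: "V (level K (Suc j))" and ab: "\<And>e. uconc (push (raise K ^^ e) V) V = V"
    and ab': "uconc V (push (raise K) V) = V"
    using assms(1) by (auto simp: absorbing_def)
  have VV: "uconc V V = V" using ab[of 0] by (simp add: push_id)
  have pV: "uconc (push (raise K) V) V = V" using ab[of 1] by simp
  define S where "S = {X. ultra X \<and> X (level K j) \<and> push (raise K) X = V}"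
  have "closed {X. push (raise K) X = V}"
  proof -
    have "closed {X. X B = b}" for B :: "nat list set" and b :: bool
    proof (cases b)
      case True
      then show ?thesis using clopen_coordinate(1)[of B] by simp
    next
      case False
      then have "{X. X B = b} = - {X. X B}" by auto
      then show ?thesis using closed_Compl[OF clopen_coordinate(2)[of B]] by simp
    qed
    then show ?thesis unfolding fun_eq_iff push_def by (intro closed_Collect_all)
  qed
  then have "closed S" unfolding S_def by (intro closed_Collect_conj closed_ultra clopen_coordinate)
  then have cS: "compact S" using compact_Int_closed[OF compact_UNIV_set_to_bool] by fastforce
  \<comment> \<open>Lowering each letter by one is inverted by \<open>raise K\<close> on level
    \<open>Suc j\<close>, where letters are at least 1. It lifts \<open>V\<close> one level down, so
    \<open>S\<close> is nonempty.\<close>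
  have "push (map (\<lambda>a. a - 1)) V \<in> S"
  proof -
    have "level K (Suc j) \<subseteq> map (\<lambda>a. a - 1) -` level K j"
    proof
      fix w assume w: "w \<in> level K (Suc j)"
      then have "Suc j \<in> set w" "set w \<subseteq> {Suc j..K}" by (auto simp: level_def)
      then show "w \<in> map (\<lambda>a. a - 1) -` level K j" by (force simp: level_def)
    qed
    then have "push (map (\<lambda>a. a - 1)) V (level K j)"
      unfolding push_def using ultra_mono[OF u lV] by blast
    moreover have "push (raise K) (push (map (\<lambda>a. a - 1)) V) = V"
    proof -
      have "raise K (map (\<lambda>a. a - 1) w) = w" if "w \<in> level K (Suc j)" for w
        using that by (force simp: level_def raise_def intro!: map_idI)
      then have "((raise K \<circ> map (\<lambda>a. a - 1)) -` A) \<inter> level K (Suc j) = A \<inter> level K (Suc j)" for A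
        by auto
      then show ?thesis
        unfolding push_push unfolding push_def by (intro ext ultra_cong_on[OF u lV])
    qed
    ultimately show ?thesis using ultra_push[OF u] by (simp add: S_def)
  qed
  then have Sne: "S \<noteq> {}" by blast
  have push_u: "push (raise K) (uconc p q) = uconc (push (raise K) p) (push (raise K) q)" for p q
    by (rule push_uconc) (rule raise_append)
  \<comment> \<open>\<open>raise K\<close> sends this product to that of \<open>V\<close> with its
    raised copy, which is \<open>V\<close> by the right absorption law.\<close>
  have SV: "uconc X V \<in> S" if "X \<in> S" for X
    using that ultra_uconc[of X V] uconc_conc[of X V "level K j" "level K (Suc j)" "level K j"] level_append2 u lV
      ab' push_u
    unfolding S_def mem_Collect_eq by metis
  have SS: "uconc X Y \<in> S" if "X \<in> S" "Y \<in> S" for X Y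
    using that ultra_uconc[of X Y] uconc_conc[of X Y "level K j" "level K j" "level K j"] level_append1 u lV
      VV push_u
    unfolding S_def mem_Collect_eq by metis
  define C where "C = (\<lambda>X. uconc X V) ` S"
  have CS: "C \<subseteq> S" using SV by (auto simp: C_def)
  have cC: "compact C" unfolding C_def by (rule compact_continuous_image[OF continuous_on_uconc cS])
  obtain E where E: "E \<in> C" "uconc E E = E"
  proof (rule ellis_numakura[where f = uconc, OF Hausdorff_set_to_bool cC])
    show "C \<noteq> {}" using Sne by (simp add: C_def)
    show "uconc x y \<in> C" if "x \<in> C" "y \<in> C" for x y
    proof -
      obtain Y where Y: "Y \<in> S" "y = uconc Y V" using \<open>y \<in> C\<close> by (auto simp: C_def)
      have "uconc x y = uconc (uconc x Y) V" by (simp add: Y uconc_assoc)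
      moreover have "uconc x Y \<in> S" using SS Y that CS by blast
      ultimately show ?thesis by (auto simp: C_def)
    qed
  qed (auto simp: uconc_assoc continuous_on_uconc)
  have EV: "uconc E V = E" using E(1) by (auto simp: C_def uconc_assoc VV)
  have ES: "ultra E" "E (level K j)" "push (raise K) E = V" using E CS by (auto simp: S_def)
  define W where "W = uconc V E"
  have W1: "ultra W" unfolding W_def by (rule ultra_uconc[OF u ES(1)])
  have W2: "W (level K j)"
    unfolding W_def by (rule uconc_conc[OF u ES(1) lV ES(2)]) (rule level_append3)
  have W3: "push (raise K) W = V" by (simp add: W_def push_u ES pV)
  have W4: "uconc V W = W" unfolding W_def uconc_assoc[symmetric] VV ..
  have W5: "uconc W V = W" unfolding W_def uconc_assoc EV ..
  have W6: "uconc W W = W" using W5 E(2) unfolding W_def by (metis uconc_assoc)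
  \<comment> \<open>One raise turns \<open>W\<close> into \<open>V\<close>; the remaining raises are
    absorbed by \<open>V\<close>, which is brought in through \<open>uconc V W = W\<close>.\<close>
  have "uconc (push (raise K ^^ e) W) W = W" for e
  proof (cases e)
    case 0
    then show ?thesis using W6 by (simp add: push_id)
  next
    case (Suc e')
    have "push (raise K ^^ e) W = push (raise K ^^ e') V"
      unfolding Suc funpow_Suc_right push_push[symmetric] W3 ..
    then have "uconc (push (raise K ^^ e) W) W = uconc (push (raise K ^^ e') V) (uconc V W)"
      by (simp only: W4)
    also have "\<dots> = uconc (uconc (push (raise K ^^ e') V) V) W" by (simp only: uconc_assoc)
    also have "\<dots> = W" by (simp only: ab W4)
    finally show ?thesis .
  qed
  then have "absorbing K j W" using W1 W2 W3 W5 by (simp add: absorbing_def)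
  then show ?thesis by blast
qed

lemma absorbing_exists: "j \<le> K \<Longrightarrow> \<exists>V. absorbing K j V"
  by (induction j rule: inc_induct) (use absorbing_top absorbing_step in auto)

text \<open>As in the ultrafilter proof of Hindman's theorem, a prefix is good (\<open>Q\<close>) if
  almost every continuation lands in a fixed large set. Absorption makes a good prefix followed by a
  raised copy of almost any block good again. Finitely many prefixes and shifts can be served by one
  block, and the bound \<open>K\<close> on shifts keeps the set of prefixes finite.\<close>

theorem gowers_words:
  fixes c :: "nat list \<Rightarrow> nat"
  assumes "\<And>w. c w < r"
  obtains b i where "\<forall>n. b n \<in> level K 0"
    "\<forall>n e. (\<forall>j<n. e j \<le> K) \<longrightarrow>
       c (concat (map (\<lambda>j. map (\<lambda>a. min K (a + e j)) (b j)) [0..<n]) @ b n) = i"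
proof -
  obtain V where "absorbing K 0 V" using absorbing_exists by blast
  then have u: "ultra V" and lV: "V (level K 0)" and ab: "\<And>e. uconc (push (raise K ^^ e) V) V = V"
    by (auto simp: absorbing_def)
  obtain i where i: "V {w. c w = i}" using ultra_colour[OF u assms] .
  define A where "A = {w. c w = i} \<inter> level K 0"
  have VA: "V A" using i lV ultra_Int[OF u] by (simp add: A_def)
  define Q where "Q s \<longleftrightarrow> V {y. s @ y \<in> A}" for s
  have Qstep: "V {b. Q (s @ (raise K ^^ e) b)}" if "Q s" for s e
  proof -
    \<comment> \<open>Replacing \<open>V\<close> by the product of its raised copy with itself
      splits the next block off from the continuation.\<close>
    have "uconc (push (raise K ^^ e) V) V {y. s @ y \<in> A}" using that unfolding ab Q_def .
    then show ?thesis by (simp add: uconc_def push_def Q_def vimage_def)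
  qed
  \<comment> \<open>A state is a block together with the prefixes built from the earlier
    blocks.\<close>
  define P where "P x \<longleftrightarrow> finite (snd x) \<and> [] \<in> snd x \<and> (\<forall>s\<in>snd x. Q s)
      \<and> fst x \<in> level K 0 \<and> (\<forall>s\<in>snd x. s @ fst x \<in> A \<and> (\<forall>e\<le>K. Q (s @ (raise K ^^ e) (fst x))))"
    for x :: "nat list \<times> nat list set"
  have ex: "\<exists>b. P (b, C)" if C: "finite C" "[] \<in> C" "\<And>s. s \<in> C \<Longrightarrow> Q s" for C
  proof -
    have "V (\<Inter>s\<in>C. {y. s @ y \<in> A})"
      by (rule ultra_INT[OF u C(1)]) (use C(3) in \<open>simp add: Q_def\<close>)
    moreover have "V (\<Inter>s\<in>C. \<Inter>e\<in>{..K}. {b. Q (s @ (raise K ^^ e) b)})"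
      by (intro ultra_INT[OF u] C(1) finite_atMost Qstep C(3))
    ultimately have "V ((\<Inter>s\<in>C. {y. s @ y \<in> A}) \<inter> (\<Inter>s\<in>C. \<Inter>e\<in>{..K}. {b. Q (s @ (raise K ^^ e) b)}) \<inter> level K 0)"
      using lV ultra_Int[OF u] by blast
    from ultra_nonempty[OF u this] show ?thesis using C by (auto simp: P_def)
  qed
  define R where "R x y \<longleftrightarrow> snd y = snd x \<union> {s @ (raise K ^^ e) (fst x) | s e. s \<in> snd x \<and> e \<le> K}"
    for x y :: "nat list \<times> nat list set"
  have "\<exists>F. \<forall>n. P (F n) \<and> R (F n) (F (Suc n))"
  proof (rule dependent_nat_choice)
    have "Q []" using VA by (simp add: Q_def)
    then have "\<exists>b. P (b, {[]})" by (intro ex) auto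
    then show "\<exists>x. P x" by blast
    fix x :: "nat list \<times> nat list set" assume x: "P x"
    let ?C = "snd x \<union> {s @ (raise K ^^ e) (fst x) | s e. s \<in> snd x \<and> e \<le> K}"
    have eq: "{s @ (raise K ^^ e) (fst x) | s e. s \<in> snd x \<and> e \<le> K} =
      (\<lambda>(s, e). s @ (raise K ^^ e) (fst x)) ` (snd x \<times> {..K})" by auto
    have "\<exists>b. P (b, ?C)"
    proof (rule ex)
      show "finite ?C" unfolding eq using x by (simp add: P_def)
    qed (use x in \<open>auto simp: P_def\<close>)
    then show "\<exists>y. P y \<and> R x y" by (auto simp: R_def)
  qed
  then obtain F where F: "\<And>n. P (F n)" "\<And>n. R (F n) (F (Suc n))" by blast
  define b where "b n = fst (F n)" for n
  have bl: "b n \<in> level K 0" for n using F(1)[of n] by (simp add: b_def P_def)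
  show thesis
  proof (rule that[of b i]; intro allI impI bl)
    fix n and e :: "nat \<Rightarrow> nat" assume e: "\<forall>j<n. e j \<le> K"
    let ?w = "\<lambda>m. concat (map (\<lambda>j. map (\<lambda>a. min K (a + e j)) (b j)) [0..<m])"
    have "?w m \<in> snd (F m)" if "m \<le> n" for m
      using that
    proof (induction m)
      case 0
      show ?case using F(1)[of 0] by (simp add: P_def)
    next
      case (Suc m)
      have "map (\<lambda>a. min K (a + e m)) (b m) = (raise K ^^ e m) (b m)"
        using bl[of m] by (subst funpow_raise) (auto simp: level_def)
      then have "?w (Suc m) = ?w m @ (raise K ^^ e m) (fst (F m))" by (simp add: b_def)
      moreover have "?w m \<in> snd (F m)" "e m \<le> K" using Suc e by auto
      ultimately show ?case using F(2)[of m] unfolding R_def by blast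
    qed
    then have "?w n \<in> snd (F n)" by blast
    then have "?w n @ b n \<in> A" using F(1)[of n] by (simp add: P_def b_def)
    then show "c (?w n @ b n) = i" by (simp add: A_def)
  qed
qed

section \<open>Path pseudometrics on lists\<close>

definition pseudometric_on :: "'b set \<Rightarrow> ('b \<Rightarrow> 'b \<Rightarrow> real) \<Rightarrow> bool" where
  "pseudometric_on V \<delta> \<longleftrightarrow> (\<forall>x\<in>V. \<delta> x x = 0) \<and> (\<forall>x\<in>V. \<forall>y\<in>V. \<delta> x y = \<delta> y x)
     \<and> (\<forall>x\<in>V. \<forall>y\<in>V. \<forall>z\<in>V. \<delta> x z \<le> \<delta> x y + \<delta> y z)"

inductive chain :: "('b \<Rightarrow> 'b \<Rightarrow> real \<Rightarrow> bool) \<Rightarrow> 'b \<Rightarrow> 'b \<Rightarrow> real \<Rightarrow> bool"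
  for E :: "'b \<Rightarrow> 'b \<Rightarrow> real \<Rightarrow> bool" where
  chain_nil: "chain E u u 0"
| chain_step: "chain E u v c \<Longrightarrow> E v w l \<Longrightarrow> chain E u w (c + l)"

text \<open>\<open>Inf\<close> of an empty set of reals is unspecified, so lower bounds and the
  triangle inequality ask for the existence of chains.\<close>

definition chain_dist :: "('b \<Rightarrow> 'b \<Rightarrow> real \<Rightarrow> bool) \<Rightarrow> 'b \<Rightarrow> 'b \<Rightarrow> real" where
  "chain_dist E u v = Inf {c. chain E u v c}"

lemma chain_single: "E u v l \<Longrightarrow> chain E u v l"
  using chain_step[OF chain_nil, of E u v l] by simp

lemma chain_trans: "chain E v w c' \<Longrightarrow> chain E u v c \<Longrightarrow> chain E u w (c + c')"
proof (induction rule: chain.induct)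
  case (chain_step v v' c' w l)
  then show ?case using chain.chain_step[of E u v' "c + c'" w l] by (simp add: add.assoc)
qed simp

lemma chain_sym:
  assumes "\<And>u v l. E u v l \<Longrightarrow> E v u l"
  shows "chain E u v c \<Longrightarrow> chain E v u c"
proof (induction rule: chain.induct)
  case (chain_nil u)
  show ?case by (rule chain.chain_nil)
next
  case (chain_step u v c w l)
  then show ?case using chain_trans[OF chain_step.IH chain_single[of E w v l]] assms
    by (simp add: add.commute)
qed

lemma chain_nonneg:
  assumes "\<And>u v l. E u v l \<Longrightarrow> 0 \<le> l"
  shows "chain E u v c \<Longrightarrow> 0 \<le> c"
  by (induction rule: chain.induct) (auto dest: assms)

lemma chain_dist_le:
  assumes "\<And>u v l. E u v l \<Longrightarrow> 0 \<le> l" "chain E u v c"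
  shows "chain_dist E u v \<le> c"
  unfolding chain_dist_def
  by (rule cInf_lower) (use assms in \<open>auto intro!: bdd_belowI[of _ 0] dest: chain_nonneg[rotated]\<close>)

lemma chain_dist_ge:
  assumes "chain E u v c0" "\<And>c. chain E u v c \<Longrightarrow> D \<le> c"
  shows "D \<le> chain_dist E u v"
  unfolding chain_dist_def by (rule cInf_greatest) (use assms in auto)

lemma pseudometric_chain_dist:
  assumes nonneg: "\<And>u v l. E u v l \<Longrightarrow> 0 \<le> l"
    and sym: "\<And>u v l. E u v l \<Longrightarrow> E v u l"
    and conn: "\<And>u v. u \<in> V \<Longrightarrow> v \<in> V \<Longrightarrow> \<exists>c. chain E u v c"
  shows "pseudometric_on V (chain_dist E)"
  unfolding pseudometric_on_def
proof (intro conjI ballI)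
  show "chain_dist E x x = 0" for x
  proof (rule antisym)
    show "chain_dist E x x \<le> 0" by (rule chain_dist_le) (auto intro: nonneg chain_nil)
    show "0 \<le> chain_dist E x x"
      by (rule chain_dist_ge[OF chain_nil]) (auto intro: chain_nonneg nonneg)
  qed
  have "chain E x y = chain E y x" for x y
    by (intro ext iffI; rule chain_sym[OF sym])
  then show "chain_dist E x y = chain_dist E y x" for x y by (simp add: chain_dist_def)
  fix x y z assume V: "x \<in> V" "y \<in> V" "z \<in> V"
  obtain c1 c2 where c: "chain E x y c1" "chain E y z c2" using conn V by blast
  \<comment> \<open>The infima over the two legs are taken one after the other, here over the first
    with the second fixed.\<close>
  have "chain_dist E x z - c \<le> chain_dist E x y" if yz: "chain E y z c" for c
  proof (rule chain_dist_ge[OF c(1)])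
    fix c' assume "chain E x y c'"
    then have "chain_dist E x z \<le> c' + c"
      by (intro chain_dist_le) (auto intro: nonneg chain_trans[OF yz])
    then show "chain_dist E x z - c \<le> c'" by simp
  qed
  then have "chain_dist E x z - chain_dist E x y \<le> chain_dist E y z"
    by (intro chain_dist_ge[OF c(2)]) (force simp: algebra_simps)
  then show "chain_dist E x z \<le> chain_dist E x y + chain_dist E y z" by simp
qed

text \<open>A relation instead of a weight function: any bound on the discrepancies is an admissible
  weight, so no supremum has to be formed. Entries beyond the shorter list are unconstrained, so
  single edges violate the triangle inequality and paths are required.\<close>

definition overlap :: "real list set \<Rightarrow> real list \<Rightarrow> real list \<Rightarrow> real \<Rightarrow> bool" where
  "overlap V u v l \<longleftrightarrow> u \<in> V \<and> v \<in> V \<and> 0 \<le> l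
     \<and> (\<forall>i<min (length u) (length v). \<bar>u ! i - v ! i\<bar> \<le> l)"

text \<open>The index \<open>m\<close> tracks the shallowest zero met along the chain: the list having it is at distance
  0 from the \<open>m\<close>-th imaginary point, so both ends of the chain are close to that point.\<close>

lemma chain_overlap:
  assumes V: "\<And>w. w \<in> V \<Longrightarrow> 0 \<in> set w" and u: "u \<in> V" and c: "chain (overlap V) u v c"
  shows "\<exists>m<min (length u) (length v). (\<forall>i\<le>m. \<bar>u ! i - v ! i\<bar> \<le> c) \<and> u ! m + v ! m \<le> c"
  using c u
proof (induction rule: chain.induct)
  case (chain_nil u)
  then obtain m where "m < length u" "u ! m = 0" using V by (metis in_set_conv_nth)
  then show ?case by (intro exI[of _ m]) auto
next
  case (chain_step u v c w l)
  then obtain m where m: "m < length u" "m < length v" "\<And>i. i \<le> m \<Longrightarrow> \<bar>u ! i - v ! i\<bar> \<le> c"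
    "u ! m + v ! m \<le> c" by auto
  have ov: "w \<in> V" "\<And>i. i < length v \<Longrightarrow> i < length w \<Longrightarrow> \<bar>v ! i - w ! i\<bar> \<le> l"
    using chain_step.hyps by (auto simp: overlap_def)
  obtain z where z: "z < length w" "w ! z = 0" using V[OF ov(1)] by (metis in_set_conv_nth)
  show ?case
  \<comment> \<open>A zero of \<open>w\<close> before \<open>m\<close> becomes the new index, the
    sum there being just \<open>u ! z\<close>. Otherwise \<open>w\<close> reaches beyond
    \<open>m\<close> and the old index survives.\<close>
  proof (cases "z < m")
    case True
    have "\<bar>u ! i - w ! i\<bar> \<le> c + l" if "i \<le> z" for i
      using m(3)[of i] ov(2)[of i] that True m(1,2) z by linarith
    moreover from this[of z] have "u ! z + w ! z \<le> c + l" using z by simp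
    ultimately show ?thesis using True m z by (intro exI[of _ z]) auto
  next
    case False
    have "\<bar>u ! i - w ! i\<bar> \<le> c + l" if "i \<le> m" for i
      using m(3)[of i] ov(2)[of i] that False m(1,2) z by linarith
    moreover have "u ! m + w ! m \<le> c + l" using m(4) ov(2)[of m] False m(1,2) z by linarith
    ultimately show ?thesis using False m z by (intro exI[of _ m]) auto
  qed
qed

lemma overlap_nonneg: "overlap V u v l \<Longrightarrow> 0 \<le> l"
  by (simp add: overlap_def)

lemma overlap_sym: "overlap V u v l \<Longrightarrow> overlap V v u l"
  by (auto simp: overlap_def abs_minus_commute min.commute)

text \<open>As all entries lie in the unit interval, the graph is connected and has diameter at most
  1.\<close>

lemma overlap_one:
  assumes "\<And>w x. w \<in> V \<Longrightarrow> x \<in> set w \<Longrightarrow> 0 \<le> x \<and> x \<le> 1" "u \<in> V" "v \<in> V"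
  shows "overlap V u v 1"
  unfolding overlap_def
proof (intro conjI allI impI)
  fix i assume "i < min (length u) (length v)"
  then have "u ! i \<in> set u" "v ! i \<in> set v" by auto
  then have "0 \<le> u ! i \<and> u ! i \<le> 1" "0 \<le> v ! i \<and> v ! i \<le> 1" using assms by blast+
  then show "\<bar>u ! i - v ! i\<bar> \<le> 1" by linarith
qed (use assms in auto)

section \<open>Distance lists built from shifted blocks\<close>

definition tagged :: "(nat \<Rightarrow> nat list) \<Rightarrow> nat \<Rightarrow> (nat \<times> nat) list" where
  "tagged b n = concat (map (\<lambda>j. map (\<lambda>a. (a, j)) (b j)) [0..<Suc n])"

text \<open>The tag of a letter is its block, which determines its shift. Tags do not depend on
  \<open>r\<close>, so lists for different \<open>n\<close> and different shift functions can be
  compared entry by entry.\<close>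

definition pattern :: "nat \<Rightarrow> (nat \<Rightarrow> nat list) \<Rightarrow> (nat \<Rightarrow> nat \<Rightarrow> real) \<Rightarrow> nat \<Rightarrow> real list" where
  "pattern K b r n = map (\<lambda>(a, j). min 1 (real a / real K + r n j)) (tagged b n)"

lemma set_tagged: "set (tagged b n) = {(a, j). j \<le> n \<and> a \<in> set (b j)}"
  by (force simp: tagged_def)

lemma length_pattern: "length (pattern K b r n) = length (tagged b n)"
  by (simp add: pattern_def)

lemma tagged_prefix:
  assumes "m \<le> n"
  obtains ys where "tagged b n = tagged b m @ ys"
proof -
  have "[0..<Suc n] = [0..<Suc m] @ [Suc m..<Suc n]"
    using assms upt_add_eq_append[of 0 "Suc m" "n - m"] by simp
  then have "tagged b n = tagged b m @ concat (map (\<lambda>j. map (\<lambda>a. (a, j)) (b j)) [Suc m..<Suc n])"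
    unfolding tagged_def by (simp only: map_append concat_append)
  then show thesis by (rule that)
qed

lemma pattern_nth:
  assumes "m \<le> n" "i < length (tagged b m)"
  obtains a j where "j \<le> m" "i < length (tagged b n)"
    "\<And>r. pattern K b r m ! i = min 1 (real a / real K + r m j)"
    "\<And>r. pattern K b r n ! i = min 1 (real a / real K + r n j)"
proof -
  obtain ys where ys: "tagged b n = tagged b m @ ys" using tagged_prefix[OF assms(1)] by blast
  obtain a j where aj: "tagged b m ! i = (a, j)" by (cases "tagged b m ! i")
  then have "j \<le> m" using nth_mem[OF assms(2)] by (auto simp: set_tagged)
  moreover have "tagged b n ! i = (a, j)" using ys aj assms(2) by (simp add: nth_append)
  moreover have "i < length (tagged b n)" using ys assms(2) by simp
  ultimately show thesis using that aj assms(2) by (auto simp: pattern_def)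
qed

text \<open>Block \<open>n\<close> is shifted by \<open>r n n = 0\<close>, so its letter 0 survives
  and the list can serve as a vertex.\<close>

lemma pattern_zero:
  assumes "0 \<in> set (b n)" "r n n = 0"
  shows "0 \<in> set (pattern K b r n)"
proof -
  have "(0, n) \<in> set (tagged b n)" using assms by (simp add: set_tagged)
  then show ?thesis using assms(2) by (force simp: pattern_def)
qed

lemma min_one_diff: "\<bar>min 1 (x + p) - min 1 (x + q)\<bar> \<le> \<bar>p - q\<bar>" for x p q :: real
  by linarith

text \<open>With \<open>r = r'\<close> this compares two points of the exact copy; with different
  functions and \<open>m = n\<close> it compares exact with rounded shifts.\<close>

lemma overlap_pattern:
  assumes V: "pattern K b r m \<in> V" "pattern K b r' n \<in> V" and "m \<le> n" "0 \<le> l"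
    and le: "\<And>j. j \<le> m \<Longrightarrow> \<bar>r m j - r' n j\<bar> \<le> l"
  shows "overlap V (pattern K b r m) (pattern K b r' n) l"
  unfolding overlap_def
proof (intro conjI V \<open>0 \<le> l\<close> allI impI)
  fix i assume "i < min (length (pattern K b r m)) (length (pattern K b r' n))"
  then have "i < length (tagged b m)" by (simp add: length_pattern)
  then obtain a j where "j \<le> m" "pattern K b r m ! i = min 1 (real a / real K + r m j)"
    "pattern K b r' n ! i = min 1 (real a / real K + r' n j)"
    using pattern_nth[OF \<open>m \<le> n\<close>] by metis
  then show "\<bar>pattern K b r m ! i - pattern K b r' n ! i\<bar> \<le> l"
    using min_one_diff le[of j] by (metis order_trans)
qed

text \<open>A single edge gives the upper bound. Conversely, a chain of cost \<open>c\<close> leaves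
  a common position, in some block \<open>j\<close>, whose entries are at least
  \<open>min 1 (r m j)\<close> and \<open>min 1 (r n j)\<close> and sum to at most \<open>c\<close>;
  by the triangle inequality and \<open>r m n \<le> 1\<close> this sum is at least
  \<open>r m n\<close>.\<close>

lemma chain_dist_pattern:
  assumes V0: "\<And>w. w \<in> V \<Longrightarrow> 0 \<in> set w"
    and V: "\<And>n. pattern K b r n \<in> V"
    and r: "pseudometric_on UNIV r" "\<And>m n. r m n \<le> 1"
  shows "chain_dist (overlap V) (pattern K b r m) (pattern K b r n) = r m n"
proof -
  have r': "r x x = 0" "r x y = r y x" "r x z \<le> r x y + r y z" for x y z
    using r(1) by (auto simp: pseudometric_on_def)
  have r0: "0 \<le> r x y" for x y using r'(1)[of x] r'(3)[of x x y] r'(2)[of x y] by linarith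
  have *: "chain_dist (overlap V) (pattern K b r m) (pattern K b r n) = r m n" if "m \<le> n" for m n
  proof (rule antisym)
    have "overlap V (pattern K b r m) (pattern K b r n) (r m n)"
      using V V that r0
    proof (rule overlap_pattern)
      show "\<bar>r m j - r n j\<bar> \<le> r m n" for j
        using r'(3)[of m j n] r'(3)[of n j m] r'(2)[of m n] by linarith
    qed
    then have ch: "chain (overlap V) (pattern K b r m) (pattern K b r n) (r m n)" by (rule chain_single)
    then show "chain_dist (overlap V) (pattern K b r m) (pattern K b r n) \<le> r m n"
      by (rule chain_dist_le[rotated]) (rule overlap_nonneg)
    show "r m n \<le> chain_dist (overlap V) (pattern K b r m) (pattern K b r n)"
    proof (rule chain_dist_ge[OF ch])
      fix c assume "chain (overlap V) (pattern K b r m) (pattern K b r n) c"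
      from chain_overlap[OF V0 V this] obtain i where i: "i < length (tagged b m)"
        "pattern K b r m ! i + pattern K b r n ! i \<le> c"
        by (auto simp: length_pattern)
      obtain a j where "pattern K b r m ! i = min 1 (real a / real K + r m j)"
        "pattern K b r n ! i = min 1 (real a / real K + r n j)"
        using pattern_nth[OF \<open>m \<le> n\<close> i(1)] by metis
      moreover have "0 \<le> real a / real K" by simp
      moreover have "r m n \<le> r m j + r n j" using r'(3)[of m n j] r'(2)[of j n] by simp
      ultimately show "r m n \<le> c" using i(2) r(2)[of m n] r0[of m j] r0[of n j] by linarith
    qed
  qed
  show ?thesis
  proof (cases "m \<le> n")
    case False
    have "chain (overlap V) x y = chain (overlap V) y x" for x y
      by (intro ext iffI; rule chain_sym[OF overlap_sym])
    then show ?thesis using *[of n m] False r'(2)[of m n] by (simp add: chain_dist_def)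
  qed (rule *)
qed

section \<open>Approximate indivisibility of the Urysohn sphere\<close>

lemma urysohn_sphereD:
  assumes "urysohn_sphere S d"
  shows "Metric_space S d" "Metric_space.mcomplete S d"
    "separable_space (Metric_space.mtopology S d)" "ultrahomogeneous S d"
    "\<And>x y. x \<in> S \<Longrightarrow> y \<in> S \<Longrightarrow> d x y \<le> 1"
    "\<And>(F :: nat set) \<rho>. finite F \<Longrightarrow> Metric_space F \<rho> \<Longrightarrow> (\<And>x y. x \<in> F \<Longrightarrow> y \<in> F \<Longrightarrow> \<rho> x y \<le> 1) \<Longrightarrow>
       \<exists>f. isometric_embedding F \<rho> S d f"
  using assms unfolding urysohn_sphere_def by auto

text \<open>\<open>A\<close> with an abstract point added at the distances \<open>r\<close> embeds
  into the sphere, and ultrahomogeneity moves the embedded copy of \<open>A\<close> back onto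
  \<open>A\<close>. A zero of \<open>r\<close> would identify the new point with one of
  \<open>A\<close>, so that case is separate.\<close>

lemma urysohn_one_point_extension:
  assumes S: "urysohn_sphere S d" and A: "finite A" "A \<subseteq> S"
    and r: "\<And>a. a \<in> A \<Longrightarrow> 0 \<le> r a \<and> r a \<le> 1"
    and katetov: "\<And>a b. a \<in> A \<Longrightarrow> b \<in> A \<Longrightarrow> \<bar>r a - r b\<bar> \<le> d a b \<and> d a b \<le> r a + r b"
  obtains x where "x \<in> S" "\<And>a. a \<in> A \<Longrightarrow> d x a = r a"
proof (cases "\<exists>a\<in>A. r a = 0")
  case True
  then obtain a where a: "a \<in> A" "r a = 0" by blast
  have "d a b = r b" if "b \<in> A" for b using katetov[OF a(1) that] a(2) by linarith
  then show ?thesis using that a A by blast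
next
  case False
  interpret Metric_space S d using urysohn_sphereD(1)[OF S] .
  have rpos: "0 < r a" if "a \<in> A" for a using r[OF that] False that by force
  define n where "n = card A"
  obtain g where g: "bij_betw g {0..<n} A"
    using ex_bij_betw_nat_finite[OF A(1)] n_def by blast
  have gA: "g i \<in> A" if "i < n" for i using bij_betwE[OF g] that by simp
  have ginj: "g i = g j \<longleftrightarrow> i = j" if "i < n" "j < n" for i j
    using bij_betw_imp_inj_on[OF g] that by (auto simp: inj_on_def)
  have gS: "g i \<in> S" if "i < n" for i using gA[OF that] A by blast
  \<comment> \<open>Indices below \<open>n\<close> enumerate \<open>A\<close>, and \<open>n\<close>
    is the new point. The value 0 outside \<open>{..n}\<close> keeps \<open>\<rho>\<close>
    nonnegative and symmetric at all arguments, as \<open>Metric_space\<close> demands.\<close>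
  define \<rho> where "\<rho> i j = (if i = j \<or> n < i \<or> n < j then 0 else if i = n then r (g j)
    else if j = n then r (g i) else d (g i) (g j))" for i j :: nat
  have \<rho>: "\<rho> i i = 0" "\<rho> i j = \<rho> j i" "i < n \<Longrightarrow> \<rho> i n = r (g i)"
    "i < n \<Longrightarrow> j < n \<Longrightarrow> \<rho> i j = d (g i) (g j)" for i j
    using gS[of i] by (auto simp: \<rho>_def commute)
  have pos: "0 < \<rho> i j" if ij: "i \<le> n" "j \<le> n" "i \<noteq> j" for i j
  proof -
    consider "i = n" "j < n" | "j = n" "i < n" | "i < n" "j < n" using ij by (metis order_le_less)
    then show ?thesis
    proof cases
      case 3
      then show ?thesis using \<rho>(4)[OF 3] ginj[OF 3] that(3) gS zero[of "g i" "g j"] nonneg[of "g i" "g j"]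
        by (metis less_eq_real_def)
    qed (use \<rho>(2,3) rpos gA in metis)+
  qed
  have tri: "\<rho> x z \<le> \<rho> x y + \<rho> y z" if xyz: "x \<le> n" "y \<le> n" "z \<le> n" for x y z
  proof (cases "x = y \<or> y = z \<or> x = z")
    case True
    then show ?thesis using \<rho>(1) pos[of x y] pos[of y z] that by (metis add.left_neutral add.right_neutral add_pos_pos less_eq_real_def)
  next
    case False
    consider "x = n" "y < n" "z < n" | "y = n" "x < n" "z < n" | "z = n" "x < n" "y < n"
      | "x < n" "y < n" "z < n" using xyz False by (metis order_le_less)
    then show ?thesis
    proof cases
      case 1
      then show ?thesis using katetov[OF gA gA, of y z] \<rho>(2)[of n] \<rho>(3,4) by force
    next
      case 2
      then show ?thesis using katetov[OF gA gA, of x z] \<rho>(2)[of n] \<rho>(3,4) by force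
    next
      case 3
      then show ?thesis using katetov[OF gA gA, of x y] \<rho>(2)[of n] \<rho>(3,4) by force
    next
      case 4
      then show ?thesis using triangle[OF gS gS gS, of x y z] \<rho>(4) by force
    qed
  qed
  have ms: "Metric_space {..n} \<rho>"
  proof
    show "0 \<le> \<rho> x y" for x y
      using pos[of x y] by (cases "x \<le> n \<and> y \<le> n \<and> x \<noteq> y") (auto simp: \<rho>_def)
    show "\<rho> x y = \<rho> y x" for x y by (rule \<rho>(2))
    show "\<rho> x y = 0 \<longleftrightarrow> x = y" if "x \<in> {..n}" "y \<in> {..n}" for x y
      using pos[of x y] that \<rho>(1) by force
    show "\<rho> x z \<le> \<rho> x y + \<rho> y z" if "x \<in> {..n}" "y \<in> {..n}" "z \<in> {..n}" for x y z
      using tri that by simp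
  qed
  have "\<rho> x y \<le> 1" for x y
    using r gA gS urysohn_sphereD(5)[OF S] by (auto simp: \<rho>_def)
  then obtain f where f: "isometric_embedding {..n} \<rho> S d f"
    using urysohn_sphereD(6)[OF S finite_atMost ms] by blast
  then have fS: "f i \<in> S" if "i \<le> n" for i using that by (auto simp: isometric_embedding_def)
  have fd: "d (f i) (f j) = \<rho> i j" if "i \<le> n" "j \<le> n" for i j
    using f that by (auto simp: isometric_embedding_def)
  have finj: "inj_on f {0..<n}"
  proof (rule inj_onI)
    fix i j assume ij: "i \<in> {0..<n}" "j \<in> {0..<n}" "f i = f j"
    then have "\<rho> i j = 0" using fd[of i j] fS[of i] zero[of "f i" "f i"] by simp
    then show "i = j" using pos[of i j] ij by force
  qed
  define \<phi> where "\<phi> = g \<circ> inv_into {0..<n} f"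
  have \<phi>: "\<phi> (f i) = g i" if "i < n" for i
    using that finj by (simp add: \<phi>_def)
  have "isometry_onto (f ` {0..<n}) d A d \<phi>"
    unfolding isometry_onto_def isometric_embedding_def
  proof (intro conjI ballI)
    show "\<phi> ` f ` {0..<n} = A"
      using \<phi> bij_betw_imp_surj_on[OF g] by (force simp: image_image)
    then show "\<phi> \<in> f ` {0..<n} \<rightarrow> A" by blast
    fix x y assume "x \<in> f ` {0..<n}" "y \<in> f ` {0..<n}"
    then obtain i j where ij: "x = f i" "i < n" "y = f j" "j < n" by auto
    then show "d (\<phi> x) (\<phi> y) = d x y"
      using \<phi> fd[of i j] \<rho>(4) by simp
  qed
  moreover have "f ` {0..<n} \<subseteq> S" using fS by auto
  ultimately obtain \<psi> where \<psi>: "isometry_onto S d S d \<psi>" "\<And>x. x \<in> f ` {0..<n} \<Longrightarrow> \<psi> x = \<phi> x"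
    using urysohn_sphereD(4)[OF S] A unfolding ultrahomogeneous_def by (metis finite_atLeastLessThan finite_imageI)
  show ?thesis
  proof (rule that)
    show "\<psi> (f n) \<in> S" using \<psi>(1) fS[of n] by (auto simp: isometry_onto_def)
    fix a assume "a \<in> A"
    then obtain i where i: "i < n" "a = g i"
      using bij_betw_imp_surj_on[OF g] by force
    have "d (\<psi> (f n)) (\<psi> (f i)) = \<rho> n i"
      using \<psi>(1) fS[of n] fS[of i] fd[of n i] i
      by (auto simp: isometry_onto_def isometric_embedding_def)
    then show "d (\<psi> (f n)) a = r a"
      using \<psi>(2)[of "f i"] \<phi>[of i] i \<rho>(2)[of n i] \<rho>(3)[of i] by simp
  qed
qed

text \<open>The points are chosen one at a time by one-point extension. Since
  \<open>\<delta>\<close> may vanish off the diagonal, they may repeat.\<close>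

lemma urysohn_embed_sequence:
  assumes S: "urysohn_sphere S d" and \<delta>: "pseudometric_on UNIV \<delta>" "\<And>m n :: nat. \<delta> m n \<le> 1"
  obtains e where "\<And>n. e n \<in> S" "\<And>m n. d (e m) (e n) = \<delta> m n"
proof -
  interpret Metric_space S d using urysohn_sphereD(1)[OF S] .
  have \<delta>': "\<delta> x x = 0" "\<delta> x y = \<delta> y x" "\<delta> x z \<le> \<delta> x y + \<delta> y z" for x y z
    using \<delta>(1) by (auto simp: pseudometric_on_def)
  have \<delta>0: "0 \<le> \<delta> x y" for x y using \<delta>'(1)[of x] \<delta>'(3)[of x x y] \<delta>'(2)[of x y] by linarith
  define P where "P f n x \<longleftrightarrow> x \<in> S \<and> (\<forall>m<n. d x (f m) = \<delta> n m)" for f n x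
  have "\<exists>e. \<forall>n. P e n (e n)"
  proof (rule dependent_wf_choice[OF wf_less_than])
    show "P f x r = P g x r" if "\<And>z. (z, x) \<in> less_than \<Longrightarrow> f z = g z" for f g x r
      using that by (auto simp: P_def)
    fix n and f :: "nat \<Rightarrow> 'a" assume IH: "P f m (f m)" if "(m, n) \<in> less_than" for m
    have fS: "f m \<in> S" if "m < n" for m using IH[of m] that by (simp add: P_def)
    have fd: "d (f m) (f m') = \<delta> m m'" if "m < n" "m' < n" for m m'
    proof (cases m m' rule: linorder_cases)
      case less
      then show ?thesis using IH[of m'] that \<delta>'(2)[of m m'] commute[of "f m" "f m'"] by (simp add: P_def)
    next
      case equal
      then show ?thesis using \<delta>'(1) fS[OF that(1)] by simp
    next
      case greater
      then show ?thesis using IH[of m] that by (simp add: P_def)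
    qed
    \<comment> \<open>The prescribed distances must be a function of the point, so one index is
      picked for each point; all indices of a point are at \<open>\<delta>\<close>-distance 0 from
      each other.\<close>
    define h where "h a = (SOME m. m < n \<and> f m = a)" for a
    have h: "h a < n" "f (h a) = a" if "a \<in> f ` {..<n}" for a
      using that unfolding h_def by (auto intro: someI2)
    obtain x where x: "x \<in> S" "\<And>a. a \<in> f ` {..<n} \<Longrightarrow> d x a = \<delta> n (h a)"
    proof (rule urysohn_one_point_extension[OF S, of "f ` {..<n}" "\<lambda>a. \<delta> n (h a)"])
      show "f ` {..<n} \<subseteq> S" using fS by auto
      fix a b assume ab: "a \<in> f ` {..<n}" "b \<in> f ` {..<n}"
      have "d a b = \<delta> (h a) (h b)" using fd[OF h(1)[OF ab(1)] h(1)[OF ab(2)]] h(2) ab by simp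
      then show "\<bar>\<delta> n (h a) - \<delta> n (h b)\<bar> \<le> d a b \<and> d a b \<le> \<delta> n (h a) + \<delta> n (h b)"
        using \<delta>'(3)[of n "h a" "h b"] \<delta>'(3)[of n "h b" "h a"] \<delta>'(3)[of "h a" "h b" n]
          \<delta>'(2)[of "h a" "h b"] \<delta>'(2)[of "h a" n] by simp
    qed (use \<delta>0 \<delta>(2) in auto)
    have "d x (f m) = \<delta> n m" if m: "m < n" for m
    proof -
      have fm: "f m \<in> f ` {..<n}" using m by blast
      have "\<delta> m (h (f m)) = 0" using fd[OF m h(1)[OF fm]] h(2)[OF fm] fS[OF m] by simp
      then show ?thesis
        using x(2)[OF fm] \<delta>'(3)[of n m "h (f m)"] \<delta>'(3)[of n "h (f m)" m] \<delta>'(2)[of m "h (f m)"] by simp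
    qed
    then show "\<exists>x. P f n x" using x(1) by (auto simp: P_def)
  qed
  then obtain e where e: "\<And>n. P e n (e n)" by blast
  show ?thesis
  proof (rule that)
    show eS: "e n \<in> S" for n using e by (simp add: P_def)
    show "d (e m) (e n) = \<delta> m n" for m n
    proof (cases m n rule: linorder_cases)
      case less
      then show ?thesis using e[of n] \<delta>'(2)[of m n] commute[of "e m" "e n"] by (simp add: P_def)
    next
      case equal
      then show ?thesis using \<delta>'(1) eS by simp
    next
      case greater
      then show ?thesis using e[of m] by (simp add: P_def)
    qed
  qed
qed

lemma urysohn_embed_countable:
  assumes S: "urysohn_sphere S d" and V: "countable V" "V \<noteq> {}"
    and \<delta>: "pseudometric_on V \<delta>" "\<And>x y. x \<in> V \<Longrightarrow> y \<in> V \<Longrightarrow> \<delta> x y \<le> 1"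
  obtains e where "\<forall>v\<in>V. e v \<in> S" "\<forall>v\<in>V. \<forall>w\<in>V. d (e v) (e w) = \<delta> v w"
proof -
  \<comment> \<open>For finite \<open>V\<close> the enumeration repeats elements, which a
    pseudometric on the indices tolerates.\<close>
  define g where "g = from_nat_into V"
  have gV: "g n \<in> V" for n using V by (simp add: g_def from_nat_into)
  have "pseudometric_on UNIV (\<lambda>m n. \<delta> (g m) (g n))"
    using \<delta>(1) gV by (simp add: pseudometric_on_def)
  then obtain e where e: "\<And>n. e n \<in> S" "\<And>m n. d (e m) (e n) = \<delta> (g m) (g n)"
    using urysohn_embed_sequence[OF S, of "\<lambda>m n. \<delta> (g m) (g n)"] \<delta>(2) gV by blast
  show ?thesis
  proof (rule that[of "e \<circ> to_nat_on V"])
    show "\<forall>v\<in>V. (e \<circ> to_nat_on V) v \<in> S" using e by simp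
    show "\<forall>v\<in>V. \<forall>w\<in>V. d ((e \<circ> to_nat_on V) v) ((e \<circ> to_nat_on V) w) = \<delta> v w"
      using V(1) by (simp add: e g_def)
  qed
qed

lemma urysohn_nonempty:
  assumes "urysohn_sphere S d"
  shows "S \<noteq> {}"
  using urysohn_one_point_extension[OF assms, of "{}" "\<lambda>_. 0"] by blast

lemma urysohn_dense_sequence:
  assumes S: "urysohn_sphere S d"
  obtains y :: "nat \<Rightarrow> 'a" where "\<forall>n. y n \<in> S" "\<forall>x\<in>S. \<forall>\<eta>>0. \<exists>n. d x (y n) < \<eta>"
proof -
  interpret Metric_space S d using urysohn_sphereD(1)[OF S] .
  obtain C where C: "countable C" "C \<subseteq> S" "mtopology closure_of C = S"
    using urysohn_sphereD(3)[OF S] by (auto simp: separable_space_def)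
  have "C \<noteq> {}" using C(3) urysohn_nonempty[OF S] by auto
  then have r: "range (from_nat_into C) = C" using C(1) by (simp add: range_from_nat_into)
  show ?thesis
  proof (rule that[of "from_nat_into C"]; (intro ballI allI impI)?)
    show "from_nat_into C n \<in> S" for n using r C(2) by blast
    fix x \<eta> assume "x \<in> S" "0 < (\<eta> :: real)"
    then obtain c where "c \<in> C" "c \<in> mball x \<eta>" using C(3) unfolding metric_closure_of by blast
    then show "\<exists>n. d x (from_nat_into C n) < \<eta>" using r by (metis imageE in_mball)
  qed
qed

text \<open>The image of \<open>x\<close> is a limit of points \<open>z (s i)\<close> with
  \<open>y (s i)\<close> tending to \<open>x\<close>. It is recorded through its distances to all
  \<open>z n\<close>, which suffice to make \<open>g\<close> isometric; for \<open>x = y n\<close>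
  they say that \<open>g\<close> maps \<open>y n\<close> to \<open>z n\<close>.\<close>

lemma (in Metric_space) extend_isometric_sequence:
  assumes "mcomplete" and y: "\<And>n. y n \<in> M" and dense: "\<forall>x\<in>M. \<forall>\<eta>>0. \<exists>n. d x (y n) < \<eta>"
    and z: "\<And>n. z n \<in> M" and iso: "\<And>m n :: nat. d (z m) (z n) = d (y m) (y n)"
  obtains g where "isometric_embedding M d M d g" "\<forall>x\<in>M. \<forall>n. d (g x) (z n) = d x (y n)"
proof -
  have "\<exists>g\<in>M. \<forall>n. d g (z n) = d x (y n)" if x: "x \<in> M" for x
  proof -
    have "\<exists>s. \<forall>i. d x (y (s i)) < 1 / real (Suc i)"
      using dense x by (intro choice allI) simp
    then obtain s where s: "\<And>i. d x (y (s i)) < 1 / real (Suc i)" by blast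
    have s0: "(\<lambda>i. d x (y (s i))) \<longlonglongrightarrow> 0"
      by (rule real_tendsto_sandwich[OF _ _ tendsto_const LIMSEQ_inverse_real_of_nat])
        (use s in \<open>auto intro!: always_eventually less_imp_le simp: inverse_eq_divide\<close>)
    have "MCauchy (\<lambda>i. z (s i))"
      unfolding MCauchy_def
    proof (intro conjI allI impI)
      show "range (\<lambda>i. z (s i)) \<subseteq> M" using z by blast
      fix \<epsilon> :: real assume "0 < \<epsilon>"
      then have "\<forall>\<^sub>F i in sequentially. d x (y (s i)) < \<epsilon> / 2" using order_tendstoD(2)[OF s0, of "\<epsilon>/2"] by simp
      then obtain N where N: "\<And>i. N \<le> i \<Longrightarrow> d x (y (s i)) < \<epsilon> / 2" by (auto simp: eventually_sequentially)
      have "d (z (s n)) (z (s n')) < \<epsilon>" if "N \<le> n" "N \<le> n'" for n n'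
        using N[OF that(1)] N[OF that(2)] triangle[OF y x y, of "s n" "s n'"] iso[of "s n" "s n'"] commute[of x "y (s n)"] by linarith
      then show "\<exists>N. \<forall>n n'. N \<le> n \<longrightarrow> N \<le> n' \<longrightarrow> d (z (s n)) (z (s n')) < \<epsilon>" by blast
    qed
    then obtain l where l: "limitin mtopology (\<lambda>i. z (s i)) l sequentially"
      using assms(1) by (auto simp: mcomplete_def)
    then have lM: "l \<in> M" and l0: "(\<lambda>i. d (z (s i)) l) \<longlonglongrightarrow> 0" by (auto simp: limitin_metric_dist_null)
    have "d l (z n) = d x (y n)" for n
    proof -
      have 1: "\<bar>d l (z n) - d x (y n)\<bar> \<le> d (z (s i)) l + d x (y (s i))" for i
      proof -
        have "d l (z n) \<le> d (z (s i)) l + d (y (s i)) (y n)"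
          using triangle[OF lM z z, of n "s i"] iso[of "s i" n] commute[of l "z (s i)"] by linarith
        moreover have "d (y (s i)) (y n) \<le> d x (y (s i)) + d x (y n)"
          using triangle[OF y x y, of "s i" n] commute[of x "y (s i)"] by linarith
        moreover have "d x (y n) \<le> d x (y (s i)) + d (y (s i)) (y n)" using triangle[OF x y y] .
        moreover have "d (y (s i)) (y n) \<le> d (z (s i)) l + d l (z n)"
          using triangle[OF z lM z, of "s i" n] iso[of "s i" n] by linarith
        ultimately show ?thesis by linarith
      qed
      have "(\<lambda>i. d (z (s i)) l + d x (y (s i))) \<longlonglongrightarrow> 0" using tendsto_add[OF l0 s0] by simp
      then have "\<bar>d l (z n) - d x (y n)\<bar> \<le> 0"
        by (rule LIMSEQ_le_const) (use 1 in blast)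
      then show ?thesis by simp
    qed
    then show ?thesis using lM by blast
  qed
  then obtain g where g: "\<And>x. x \<in> M \<Longrightarrow> g x \<in> M" "\<And>x n. x \<in> M \<Longrightarrow> d (g x) (z n) = d x (y n)" by metis
  have "d (g x) (g x') = d x x'" if x: "x \<in> M" "x' \<in> M" for x x'
  proof -
    \<comment> \<open>Both distances lie within \<open>d x (y n)\<close> of
      \<open>d x' (y n)\<close>, and \<open>y n\<close> can be taken arbitrarily close to
      \<open>x\<close>.\<close>
    have "\<bar>d (g x) (g x') - d x x'\<bar> \<le> 2 * d x (y n)" for n
      using triangle[OF g(1)[OF x(1)] z g(1)[OF x(2)], of n] triangle[OF z g(1)[OF x(1)] g(1)[OF x(2)], of n]
        triangle[OF x(1) y x(2), of n] triangle[OF y x, of n] g(2)[OF x(1), of n] g(2)[OF x(2), of n]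
        commute[of "z n"] commute[of "y n"] by simp
    moreover have "\<exists>n. 2 * d x (y n) < \<eta>" if \<eta>: "0 < \<eta>" for \<eta>
    proof -
      obtain n where "d x (y n) < \<eta> / 2" using dense x(1) \<eta> by (meson half_gt_zero)
      then have "2 * d x (y n) < \<eta>" by simp
      then show ?thesis by blast
    qed
    ultimately have "\<bar>d (g x) (g x') - d x x'\<bar> < \<eta>" if "0 < \<eta>" for \<eta> using that by (meson le_less_trans)
    then show ?thesis by (metis abs_ge_zero eq_iff_diff_eq_0 less_irrefl zero_less_abs_iff)
  qed
  then have "isometric_embedding M d M d g" using g(1) by (auto simp: isometric_embedding_def)
  then show ?thesis using that g(2) by blast
qed

section \<open>Rounding of distances and the monochromatic copy\<close>

lemma abs_diff_max_one_ceiling: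
  fixes x :: real
  assumes "0 \<le> x"
  shows "\<bar>x - real (max 1 (nat \<lceil>x\<rceil>))\<bar> \<le> 1"
proof (cases "x = 0")
  case False
  then have x: "1 \<le> \<lceil>x\<rceil>" using assms by (simp add: less_le)
  then have "max 1 (nat \<lceil>x\<rceil>) = nat \<lceil>x\<rceil>" by linarith
  moreover have "real (nat \<lceil>x\<rceil>) = of_int \<lceil>x\<rceil>" using x by (intro of_nat_nat) simp
  ultimately have "real (max 1 (nat \<lceil>x\<rceil>)) = of_int \<lceil>x\<rceil>" by (simp only:)
  then show ?thesis using ceiling_correct[of x] by linarith
qed simp

theorem urysohn_sphere_approximately_indivisible:
  assumes S: "urysohn_sphere S d"
  shows "approximately_indivisible S d"
  unfolding approximately_indivisible_def eps_indivisible_def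
proof (intro allI impI)
  fix \<epsilon> :: real and k :: nat and c :: "'a \<Rightarrow> nat"
  assume \<epsilon>: "\<epsilon> > 0" and kc: "1 \<le> k \<and> c \<in> S \<rightarrow> {..<k}"
  interpret Metric_space S d using urysohn_sphereD(1)[OF S] .
  obtain y :: "nat \<Rightarrow> 'a" where y': "\<forall>n. y n \<in> S" and dense: "\<forall>x\<in>S. \<forall>\<eta>>0. \<exists>n. d x (y n) < \<eta>"
    by (rule urysohn_dense_sequence[OF S], rule that)
  have y: "y n \<in> S" for n using y' by blast
  \<comment> \<open>\<open>1 / real K\<close> pays for rounding the shifts; the slack up to
    \<open>\<epsilon>\<close> pays for approximating points by the sequence
    \<open>y\<close>.\<close>
  obtain K where K: "0 < K" "1 / real K < \<epsilon>"
    using ex_inverse_of_nat_less[OF \<epsilon>] by (auto simp: inverse_eq_divide)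
  have d1: "d (y m) (y n) \<le> 1" for m n using urysohn_sphereD(5)[OF S y y] .
  \<comment> \<open>Shifts in units of \<open>1 / real K\<close>; at distance 0 the value 1 is still
    only one unit off. The diagonal is 0 by a separate case, since \<open>max 1\<close> would raise
    the last block and destroy its zero.\<close>
  define s where "s n j = (if n = j then 0 else max 1 (nat \<lceil>real K * d (y n) (y j)\<rceil>))" for n j
  have sK: "s n j \<le> K" for n j
  proof -
    have "real K * d (y n) (y j) \<le> real K" using d1[of n j] by (simp add: mult_left_le)
    then have "nat \<lceil>real K * d (y n) (y j)\<rceil> \<le> K" by linarith
    then show ?thesis using K by (simp add: s_def)
  qed
  have sd: "\<bar>d (y n) (y j) - real (s n j) / real K\<bar> \<le> 1 / real K" for n j
  proof (cases "n = j")
    case True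
    then show ?thesis using y by (simp add: s_def)
  next
    case False
    have "\<bar>real K * d (y n) (y j) - real (s n j)\<bar> \<le> 1"
      using False abs_diff_max_one_ceiling[of "real K * d (y n) (y j)"] by (simp add: s_def)
    then have "\<bar>real K * d (y n) (y j) - real (s n j)\<bar> / real K \<le> 1 / real K"
      by (rule divide_right_mono) simp
    moreover have "\<bar>real K * d (y n) (y j) - real (s n j)\<bar> / real K = \<bar>d (y n) (y j) - real (s n j) / real K\<bar>"
    proof -
      have "d (y n) (y j) - real (s n j) / real K = (real K * d (y n) (y j) - real (s n j)) / real K"
        using K by (simp add: field_simps)
      then show ?thesis by (simp only: abs_divide abs_of_nat)
    qed
    ultimately show ?thesis by simp
  qed
  \<comment> \<open>With exact distances and multiples of \<open>1 / real K\<close> both in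
    \<open>D\<close>, the lists with exact and with rounded shifts are vertices of the same graph,
    whose vertex set is countable.\<close>
  define D where "D = range (\<lambda>(n, j). d (y n) (y j)) \<union> range (\<lambda>m :: nat. real m / real K)"
  define R0 where "R0 = (\<lambda>(a :: nat, t). min 1 (real a / real K + t)) ` (UNIV \<times> D)"
  define V where "V = {w \<in> lists R0. 0 \<in> set w}"
  have D0: "0 \<le> t" if "t \<in> D" for t using that by (auto simp: D_def)
  have cV: "countable V"
  proof (rule countable_subset)
    show "V \<subseteq> lists R0" by (auto simp: V_def)
    have "countable D" by (simp add: D_def)
    then show "countable (lists R0)" unfolding R0_def by (intro countable_lists countable_image countable_SIGMA) auto
  qed
  have V0: "0 \<in> set w" if "w \<in> V" for w using that by (simp add: V_def)
  have V1: "0 \<le> x \<and> x \<le> 1" if "w \<in> V" "x \<in> set w" for w x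
  proof -
    have "x \<in> R0" using that by (auto simp: V_def)
    then obtain a t where "x = min 1 (real a / real K + t)" "t \<in> D" by (auto simp: R0_def)
    then show ?thesis using D0 by simp
  qed
  define \<delta> where "\<delta> = chain_dist (overlap V)"
  have chain1: "chain (overlap V) u v 1" if "u \<in> V" "v \<in> V" for u v
    using overlap_one[OF V1 that] by (rule chain_single)
  have ps: "pseudometric_on V \<delta>"
    unfolding \<delta>_def by (rule pseudometric_chain_dist) (auto intro: overlap_nonneg overlap_sym chain1)
  have \<delta>1: "\<delta> u v \<le> 1" if "u \<in> V" "v \<in> V" for u v
    unfolding \<delta>_def using chain1[OF that] by (rule chain_dist_le[rotated]) (rule overlap_nonneg)
  have pat: "pattern K b r n \<in> V" if "0 \<in> set (b n)" "r n n = 0" "\<And>n j. r n j \<in> D" for b r n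
    unfolding V_def
  proof (intro CollectI conjI)
    have "min 1 (real a / real K + r n j) \<in> R0" for a j
      unfolding R0_def by (rule image_eqI[of _ _ "(a, r n j)"]) (use that(3) in auto)
    then show "pattern K b r n \<in> lists R0" by (auto simp: pattern_def)
    show "0 \<in> set (pattern K b r n)" by (rule pattern_zero) (fact that)+
  qed
  have "0 \<in> D" unfolding D_def by (intro UnI2 range_eqI[of _ _ 0]) simp
  then have "0 \<in> R0" unfolding R0_def by (intro image_eqI[of _ _ "(0, 0)"]) auto
  then have "[0] \<in> V" by (simp add: V_def)
  then have Vne: "V \<noteq> {}" by blast
  obtain e where e': "\<forall>v\<in>V. e v \<in> S" "\<forall>v\<in>V. \<forall>w\<in>V. d (e v) (e w) = \<delta> v w"
    by (rule urysohn_embed_countable[OF S cV Vne ps \<delta>1], assumption, assumption, rule that)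
  then have e: "\<And>v. v \<in> V \<Longrightarrow> e v \<in> S" "\<And>v w. v \<in> V \<Longrightarrow> w \<in> V \<Longrightarrow> d (e v) (e w) = \<delta> v w"
    by blast+
  \<comment> \<open>A word whose scaled list is not a vertex gets the default colour 0; the words
    used below all give vertices.\<close>
  define col where "col w = (let v = map (\<lambda>a. real a / real K) w in if v \<in> V then c (e v) else 0)" for w
  have col: "col w < k" for w using kc e(1) by (auto simp: col_def Let_def)
  obtain b i where b: "\<forall>n. b n \<in> level K 0" and mono:
    "\<forall>n e. (\<forall>j<n. e j \<le> K) \<longrightarrow>
       col (concat (map (\<lambda>j. map (\<lambda>a. min K (a + e j)) (b j)) [0..<n]) @ b n) = i"
    by (rule gowers_words[of col k K, OF col], rule that)
  have b0: "0 \<in> set (b n)" "set (b n) \<subseteq> {..K}" for n using b[rule_format, of n] by (auto simp: level_def)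
  define t where "t n j = real (s n j) / real K" for n j
  define r where "r m n = d (y m) (y n)" for m n
  have tV: "pattern K b t n \<in> V" for n
    by (rule pat) (use b0 in \<open>auto simp: t_def s_def D_def\<close>)
  have rV: "pattern K b r n \<in> V" for n
    by (rule pat) (use b0 y in \<open>auto simp: r_def D_def\<close>)
  have "c (e (pattern K b t n)) = i" for n
  proof -
    \<comment> \<open>Truncation at \<open>K\<close> becomes truncation at 1 after scaling, and
      \<open>t n n = 0\<close> leaves the last block unshifted.\<close>
    have "pattern K b t n = map (\<lambda>a. real a / real K)
      (concat (map (\<lambda>j. map (\<lambda>a. min K (a + s n j)) (b j)) [0..<n]) @ b n)"
    proof -
      have "min 1 (real a / real K + t n j) = real (min K (a + s n j)) / real K" for a j
        using K by (auto simp: t_def min_def field_simps simp flip: of_nat_add)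
      moreover have "map (\<lambda>a. min 1 (real a / real K + t n n)) (b n) = map (\<lambda>a. real a / real K) (b n)"
        using K b0(2)[of n] by (intro map_cong) (auto simp: t_def s_def min_def field_simps)
      ultimately show ?thesis
        by (simp add: pattern_def tagged_def map_concat comp_def)
    qed
    then show ?thesis using mono[rule_format, of n "s n"] sK tV[of n] by (simp add: col_def Let_def)
  qed
  note colour = this
  have psr: "pseudometric_on UNIV r"
    using y triangle commute by (auto simp: pseudometric_on_def r_def)
  define z where "z n = e (pattern K b r n)" for n
  have zS: "z n \<in> S" for n using e(1) rV by (simp add: z_def)
  have zd: "d (z m) (z n) = d (y m) (y n)" for m n
    unfolding z_def e(2)[OF rV rV] \<delta>_def
    using chain_dist_pattern[OF V0 rV psr, of m n] d1 by (simp add: r_def)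
  obtain g where g: "isometric_embedding S d S d g" "\<forall>x\<in>S. \<forall>n. d (g x) (z n) = d x (y n)"
    by (rule extend_isometric_sequence[OF urysohn_sphereD(2)[OF S] y dense zS zd], rule that)
  have gS: "g x \<in> S" if "x \<in> S" for x using g(1) that by (auto simp: isometric_embedding_def)
  \<comment> \<open>The exact and the rounded list have the same letters at the same positions and
    differ only in the shifts, so one edge joins them.\<close>
  have near: "d (z n) (e (pattern K b t n)) \<le> 1 / real K" for n
  proof -
    have "overlap V (pattern K b r n) (pattern K b t n) (1 / real K)"
      by (rule overlap_pattern[OF rV tV]) (use sd in \<open>auto simp: r_def t_def\<close>)
    then have "\<delta> (pattern K b r n) (pattern K b t n) \<le> 1 / real K"
      unfolding \<delta>_def by (intro chain_dist_le chain_single) (auto intro: overlap_nonneg)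
    then show ?thesis unfolding z_def e(2)[OF rV tV] .
  qed
  have "i < k" using colour[of 0] e(1)[OF tV[of 0]] kc by auto
  moreover have "isometric S d (g ` S) d" using g(1) unfolding isometric_def isometry_onto_def
    by (intro exI[of _ g]) (auto simp: isometric_embedding_def)
  moreover have "g ` S \<subseteq> thickening S d \<epsilon> {x \<in> S. c x = i}"
  proof clarify
    fix x assume x: "x \<in> S"
    obtain n where n: "d x (y n) < \<epsilon> - 1 / real K" using dense x K(2) by (meson diff_gt_0_iff_gt)
    have "d (g x) (e (pattern K b t n)) \<le> d (g x) (z n) + d (z n) (e (pattern K b t n))"
      by (rule triangle[OF gS[OF x] zS e(1)[OF tV]])
    then have "d (g x) (e (pattern K b t n)) \<le> \<epsilon>" using g(2) x n near[of n] by simp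
    then show "g x \<in> thickening S d \<epsilon> {x \<in> S. c x = i}"
      using gS[OF x] e(1)[OF tV] colour unfolding thickening_def by blast
  qed
  moreover have "g ` S \<subseteq> S" using gS by blast
  ultimately show "\<exists>i<k. \<exists>N\<subseteq>S. isometric S d N d \<and> N \<subseteq> thickening S d \<epsilon> {x \<in> S. c x = i}" by blast
qed

section \<open>The isometry group\<close>

definition iso_near :: "'a set \<Rightarrow> ('a \<Rightarrow> 'a \<Rightarrow> real) \<Rightarrow> ('a \<Rightarrow> 'a) \<Rightarrow> 'a set \<Rightarrow> real \<Rightarrow> ('a \<Rightarrow> 'a) set" where
  "iso_near M d \<phi> A \<epsilon> = {g \<in> iso_set M d. \<forall>a\<in>A. d (g a) (\<phi> a) < \<epsilon>}"

text \<open>\<open>\<phi>\<close> may be any map. For a self-embedding that is not onto, this is the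
  trace of its neighbourhoods on the isometry group and serves as a point of the completion.\<close>

definition iso_nhds :: "'a set \<Rightarrow> ('a \<Rightarrow> 'a \<Rightarrow> real) \<Rightarrow> ('a \<Rightarrow> 'a) \<Rightarrow> ('a \<Rightarrow> 'a) filter" where
  "iso_nhds M d \<phi> =
     (INF p\<in>{A. finite A \<and> A \<subseteq> M} \<times> {0<..}. principal (iso_near M d \<phi> (fst p) (snd p)))"

lemma eventually_iso_nhds:
  "eventually P (iso_nhds M d \<phi>) \<longleftrightarrow>
     (\<exists>A \<epsilon>. finite A \<and> A \<subseteq> M \<and> 0 < \<epsilon> \<and> (\<forall>g\<in>iso_near M d \<phi> A \<epsilon>. P g))"
proof -
  have "eventually P (iso_nhds M d \<phi>) \<longleftrightarrow>
      (\<exists>p\<in>{A. finite A \<and> A \<subseteq> M} \<times> {0<..}. eventually P (principal (iso_near M d \<phi> (fst p) (snd p))))"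
    unfolding iso_nhds_def
  proof (rule eventually_INF_base)
    have "({}, 1 :: real) \<in> {A. finite A \<and> A \<subseteq> M} \<times> {0<..}" by simp
    then show "{A. finite A \<and> A \<subseteq> M} \<times> {0 :: real<..} \<noteq> {}" by blast
    fix p q :: "'a set \<times> real"
    assume "p \<in> {A. finite A \<and> A \<subseteq> M} \<times> {0<..}" "q \<in> {A. finite A \<and> A \<subseteq> M} \<times> {0<..}"
    then have "(fst p \<union> fst q, min (snd p) (snd q)) \<in> {A. finite A \<and> A \<subseteq> M} \<times> {0<..}"
      by auto
    moreover have "principal (iso_near M d \<phi> (fst p \<union> fst q) (min (snd p) (snd q)))
        \<le> inf (principal (iso_near M d \<phi> (fst p) (snd p))) (principal (iso_near M d \<phi> (fst q) (snd q)))"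
      by (auto simp: iso_near_def)
    ultimately show "\<exists>x\<in>{A. finite A \<and> A \<subseteq> M} \<times> {0<..}.
      principal (iso_near M d \<phi> (fst x) (snd x))
        \<le> inf (principal (iso_near M d \<phi> (fst p) (snd p))) (principal (iso_near M d \<phi> (fst q) (snd q)))"
      by (intro bexI[of _ "(fst p \<union> fst q, min (snd p) (snd q))"]) simp_all
  qed
  then show ?thesis unfolding eventually_principal by auto
qed

lemma iso_nhds_near:
  assumes "finite A" "A \<subseteq> M" "0 < \<epsilon>"
  shows "eventually (\<lambda>g. g \<in> iso_near M d \<phi> A \<epsilon>) (iso_nhds M d \<phi>)"
  unfolding eventually_iso_nhds using assms by blast

lemma iso_nhds_le_principal: "iso_nhds M d \<phi> \<le> principal (iso_set M d)"
proof -
  have "eventually (\<lambda>g. g \<in> iso_near M d \<phi> {} 1) (iso_nhds M d \<phi>)" by (rule iso_nhds_near) auto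
  then have "eventually (\<lambda>g. g \<in> iso_set M d) (iso_nhds M d \<phi>)" by (simp add: iso_near_def)
  then show ?thesis by (simp add: le_principal)
qed

text \<open>Embeddings are not taken extensional, so several functions name the same point of the
  completion.\<close>

lemma iso_nhds_cong:
  assumes "\<And>x. x \<in> M \<Longrightarrow> \<phi> x = \<psi> x"
  shows "iso_nhds M d \<phi> = iso_nhds M d \<psi>"
proof -
  have "iso_near M d \<phi> A \<epsilon> = iso_near M d \<psi> A \<epsilon>" if "A \<subseteq> M" for A \<epsilon>
    using assms that unfolding iso_near_def by (metis subsetD)
  then show ?thesis unfolding iso_nhds_def by (intro INF_cong) auto
qed

context Metric_space
begin

lemma iso_setD:
  assumes "g \<in> iso_set M d"
  shows "x \<in> M \<Longrightarrow> g x \<in> M" "x \<in> M \<Longrightarrow> y \<in> M \<Longrightarrow> d (g x) (g y) = d x y" "g ` M = M"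
    "g \<in> extensional M"
  using assms by (auto simp: iso_set_def isometry_onto_def isometric_embedding_def)

lemma iso_setI:
  assumes "g \<in> extensional M" "g ` M = M" "\<And>x y. x \<in> M \<Longrightarrow> y \<in> M \<Longrightarrow> d (g x) (g y) = d x y"
  shows "g \<in> iso_set M d"
  using assms by (auto simp: iso_set_def isometry_onto_def isometric_embedding_def)

lemma iso_set_Bij:
  assumes g: "g \<in> iso_set M d"
  shows "g \<in> Bij M"
proof -
  have "inj_on g M"
  proof (rule inj_onI)
    fix x y assume xy: "x \<in> M" "y \<in> M" "g x = g y"
    then have "d x y = 0" using iso_setD(2)[OF g xy(1,2)] iso_setD(1)[OF g] by simp
    then show "x = y" using xy by simp
  qed
  then show ?thesis using iso_setD(3,4)[OF g] by (simp add: Bij_def bij_betw_def)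
qed

lemma subgroup_iso_set: "subgroup (iso_set M d) (BijGroup M)"
proof
  show "iso_set M d \<subseteq> carrier (BijGroup M)" using iso_set_Bij by (auto simp: BijGroup_def)
  show "x \<otimes>\<^bsub>BijGroup M\<^esub> y \<in> iso_set M d" if "x \<in> iso_set M d" "y \<in> iso_set M d" for x y
  proof -
    have "compose M x y \<in> iso_set M d"
    proof (rule iso_setI)
      show "compose M x y ` M = M"
        using iso_setD(3)[OF that(1)] iso_setD(3)[OF that(2)] by (auto simp: compose_def image_iff) (metis image_iff)+
    qed (use iso_setD[OF that(1)] iso_setD[OF that(2)] in \<open>auto simp: compose_def\<close>)
    then show ?thesis using iso_set_Bij that by (simp add: BijGroup_def)
  qed
  show "\<one>\<^bsub>BijGroup M\<^esub> \<in> iso_set M d"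
    by (rule iso_setI) (auto simp: BijGroup_def)
  show "inv\<^bsub>BijGroup M\<^esub> x \<in> iso_set M d" if x: "x \<in> iso_set M d" for x
  proof -
    have B: "bij_betw x M M" using iso_set_Bij[OF x] by (simp add: Bij_def)
    have B': "bij_betw (inv_into M x) M M" using bij_betw_inv_into[OF B] .
    have "restrict (inv_into M x) M \<in> iso_set M d"
    proof (rule iso_setI)
      show "restrict (inv_into M x) M ` M = M" using B' by (simp add: bij_betw_def)
      fix y z assume yz: "y \<in> M" "z \<in> M"
      then have "inv_into M x y \<in> M" "inv_into M x z \<in> M" using B' by (auto simp: bij_betw_def)
      then have "d (inv_into M x y) (inv_into M x z) = d (x (inv_into M x y)) (x (inv_into M x z))"
        using iso_setD(2)[OF x] by simp
      also have "\<dots> = d y z" using yz iso_setD(3)[OF x] by (simp add: f_inv_into_f)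
      finally show "d (restrict (inv_into M x) M y) (restrict (inv_into M x) M z) = d y z" using yz by simp
    qed simp
    then show ?thesis using inv_BijGroup[OF iso_set_Bij[OF x]] by simp
  qed
qed

lemma group_iso_group: "group (iso_group M d)"
  unfolding iso_group_def by (rule subgroup.subgroup_is_group[OF subgroup_iso_set group_BijGroup])

lemma carrier_iso_group: "carrier (iso_group M d) = iso_set M d"
  by (simp add: iso_group_def)

lemma iso_group_mult:
  assumes "g \<in> iso_set M d" "h \<in> iso_set M d"
  shows "g \<otimes>\<^bsub>iso_group M d\<^esub> h = compose M g h"
  using assms iso_set_Bij by (simp add: iso_group_def BijGroup_def)

lemma iso_group_mult_apply:
  assumes "g \<in> iso_set M d" "h \<in> iso_set M d" "x \<in> M"
  shows "(g \<otimes>\<^bsub>iso_group M d\<^esub> h) x = g (h x)"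
  using assms by (simp add: iso_group_mult compose_def)

lemma iso_group_mult_closed:
  assumes "g \<in> iso_set M d" "h \<in> iso_set M d"
  shows "g \<otimes>\<^bsub>iso_group M d\<^esub> h \<in> iso_set M d"
  using monoid.m_closed[OF group.is_monoid[OF group_iso_group]] assms carrier_iso_group by blast

lemma iso_group_one: "\<one>\<^bsub>iso_group M d\<^esub> = (\<lambda>x\<in>M. x)"
  by (simp add: iso_group_def BijGroup_def)

lemma iso_group_inv:
  assumes g: "g \<in> iso_set M d"
  shows "inv\<^bsub>iso_group M d\<^esub> g \<in> iso_set M d"
    and "x \<in> M \<Longrightarrow> (inv\<^bsub>iso_group M d\<^esub> g) (g x) = x"
    and "x \<in> M \<Longrightarrow> g ((inv\<^bsub>iso_group M d\<^esub> g) x) = x"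
proof -
  have c: "g \<in> carrier (iso_group M d)" using g carrier_iso_group by simp
  show i: "inv\<^bsub>iso_group M d\<^esub> g \<in> iso_set M d"
    using group.inv_closed[OF group_iso_group c] carrier_iso_group by simp
  show "(inv\<^bsub>iso_group M d\<^esub> g) (g x) = x" if "x \<in> M"
    using iso_group_mult_apply[OF i g that] group.l_inv[OF group_iso_group c] iso_group_one that by simp
  show "g ((inv\<^bsub>iso_group M d\<^esub> g) x) = x" if "x \<in> M"
    using iso_group_mult_apply[OF g i that] group.r_inv[OF group_iso_group c] iso_group_one that by simp
qed

section \<open>The pointwise topology: topological group and continuous action\<close>

lemma topspace_iso_topology: "topspace (iso_topology M d) = iso_set M d"
proof -
  have "iso_set M d \<subseteq> PiE M (\<lambda>_. M)" using iso_setD by (auto simp: PiE_def)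
  then show ?thesis by (auto simp: iso_topology_def)
qed

lemma continuous_map_iso_eval:
  assumes "x \<in> M"
  shows "continuous_map (iso_topology M d) mtopology (\<lambda>g. g x)"
  unfolding iso_topology_def
  by (rule continuous_map_from_subtopology[OF continuous_map_product_projection[OF assms]])

lemma continuous_map_into_iso_topology:
  assumes "\<And>p. p \<in> topspace X \<Longrightarrow> F p \<in> iso_set M d"
    and "\<And>x. x \<in> M \<Longrightarrow> continuous_map X mtopology (\<lambda>p. F p x)"
  shows "continuous_map X (iso_topology M d) F"
  unfolding iso_topology_def continuous_map_in_subtopology continuous_map_componentwise
  using assms iso_setD(4) by blast

lemma openin_iso_near_point:
  assumes "x \<in> M" "y \<in> M"
  shows "openin (iso_topology M d) {g \<in> iso_set M d. d y (g x) < \<epsilon>}"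
proof -
  have "openin (iso_topology M d) {g \<in> topspace (iso_topology M d). g x \<in> mball y \<epsilon>}"
    by (rule openin_continuous_map_preimage[OF continuous_map_iso_eval[OF assms(1)] openin_mball])
  moreover have "{g \<in> topspace (iso_topology M d). g x \<in> mball y \<epsilon>} = {g \<in> iso_set M d. d y (g x) < \<epsilon>}"
    using assms iso_setD(1) by (auto simp: topspace_iso_topology)
  ultimately show ?thesis by simp
qed

lemma topological_group_iso: "topological_group (iso_group M d) (iso_topology M d)"
  unfolding topological_group_def
proof (intro conjI group_iso_group)
  let ?T = "iso_topology M d"
  show "topspace ?T = carrier (iso_group M d)" by (simp add: topspace_iso_topology carrier_iso_group)
  show "continuous_map (prod_topology ?T ?T) ?T (\<lambda>(x, y). x \<otimes>\<^bsub>iso_group M d\<^esub> y)"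
  proof (rule continuous_map_into_iso_topology)
    show "(case p of (x, y) \<Rightarrow> x \<otimes>\<^bsub>iso_group M d\<^esub> y) \<in> iso_set M d"
      if "p \<in> topspace (prod_topology ?T ?T)" for p
      using that iso_group_mult_closed by (auto simp: topspace_iso_topology)
    fix x assume x: "x \<in> M"
    show "continuous_map (prod_topology ?T ?T) mtopology (\<lambda>p. (case p of (x, y) \<Rightarrow> x \<otimes>\<^bsub>iso_group M d\<^esub> y) x)"
      unfolding continuous_map_to_metric
    proof (intro ballI allI impI)
      fix p \<epsilon> assume "p \<in> topspace (prod_topology ?T ?T)" and \<epsilon>: "0 < (\<epsilon> :: real)"
      then obtain g h where p: "p = (g, h)" and g: "g \<in> iso_set M d" and h: "h \<in> iso_set M d"
        by (auto simp: topspace_iso_topology)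
      \<comment> \<open>\<open>g'\<close> is tested at \<open>h x\<close>; as \<open>g'\<close>
        preserves distances, passing from \<open>h x\<close> to \<open>h' x\<close> costs less than
        another \<open>\<epsilon> / 2\<close>.\<close>
      let ?U = "{g' \<in> iso_set M d. d (g (h x)) (g' (h x)) < \<epsilon> / 2}"
      let ?V = "{h' \<in> iso_set M d. d (h x) (h' x) < \<epsilon> / 2}"
      have hx: "h x \<in> M" "g (h x) \<in> M" using iso_setD(1) g h x by auto
      have "openin (prod_topology ?T ?T) (?U \<times> ?V)"
        using openin_iso_near_point[OF hx] openin_iso_near_point[OF x hx(1)]
        unfolding openin_prod_Times_iff by blast
      moreover have "p \<in> ?U \<times> ?V" using p g h hx \<epsilon> by simp
      moreover have "(case q of (x, y) \<Rightarrow> x \<otimes>\<^bsub>iso_group M d\<^esub> y) x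
          \<in> mball ((case p of (x, y) \<Rightarrow> x \<otimes>\<^bsub>iso_group M d\<^esub> y) x) \<epsilon>" if "q \<in> ?U \<times> ?V" for q
      proof -
        obtain g' h' where q: "q = (g', h')" by (cases q)
        then have g': "g' \<in> iso_set M d" and h': "h' \<in> iso_set M d"
          and lt: "d (g (h x)) (g' (h x)) < \<epsilon> / 2" "d (h x) (h' x) < \<epsilon> / 2" using that by auto
        have M': "h' x \<in> M" "g' (h x) \<in> M" "g' (h' x) \<in> M" using iso_setD(1) g' h' x hx by auto
        have "d (g (h x)) (g' (h' x)) < \<epsilon>"
          using triangle[OF hx(2) M'(2,3)] iso_setD(2)[OF g' hx(1) M'(1)] lt by simp
        then show ?thesis
          using hx M' by (simp add: p q iso_group_mult_apply[OF g h x] iso_group_mult_apply[OF g' h' x])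
      qed
      ultimately show "\<exists>U. openin (prod_topology ?T ?T) U \<and> p \<in> U \<and>
          (\<forall>q\<in>U. (case q of (x, y) \<Rightarrow> x \<otimes>\<^bsub>iso_group M d\<^esub> y) x
            \<in> mball ((case p of (x, y) \<Rightarrow> x \<otimes>\<^bsub>iso_group M d\<^esub> y) x) \<epsilon>)"
        by (intro exI[of _ "?U \<times> ?V"]) blast
    qed
  qed
  show "continuous_map ?T ?T (\<lambda>x. inv\<^bsub>iso_group M d\<^esub> x)"
  proof (rule continuous_map_into_iso_topology)
    show "inv\<^bsub>iso_group M d\<^esub> g \<in> iso_set M d" if "g \<in> topspace ?T" for g
      using that iso_group_inv(1) by (simp add: topspace_iso_topology)
    fix x assume x: "x \<in> M"
    show "continuous_map ?T mtopology (\<lambda>g. (inv\<^bsub>iso_group M d\<^esub> g) x)"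
      unfolding continuous_map_to_metric
    proof (intro ballI allI impI)
      fix g \<epsilon> assume "g \<in> topspace ?T" and \<epsilon>: "0 < (\<epsilon> :: real)"
      then have g: "g \<in> iso_set M d" by (simp add: topspace_iso_topology)
      let ?y = "(inv\<^bsub>iso_group M d\<^esub> g) x"
      \<comment> \<open>Applying \<open>g'\<close> shows that the inverses of \<open>g\<close> and
        \<open>g'\<close> differ at \<open>x\<close> by the distance from \<open>g' ?y\<close> to
        \<open>x\<close>, so testing \<open>g'\<close> at \<open>?y\<close> suffices.\<close>
      let ?U = "{g' \<in> iso_set M d. d x (g' ?y) < \<epsilon>}"
      have y: "?y \<in> M" using iso_setD(1)[OF iso_group_inv(1)[OF g] x] .
      have "openin ?T ?U" by (rule openin_iso_near_point[OF y x])
      moreover have "g \<in> ?U" using g x \<epsilon> iso_group_inv(3)[OF g x] by simp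
      moreover have "(inv\<^bsub>iso_group M d\<^esub> g') x \<in> mball ?y \<epsilon>" if "g' \<in> ?U" for g'
      proof -
        have g': "g' \<in> iso_set M d" and lt: "d x (g' ?y) < \<epsilon>" using that by auto
        have y': "(inv\<^bsub>iso_group M d\<^esub> g') x \<in> M" using iso_setD(1)[OF iso_group_inv(1)[OF g'] x] .
        have "d (g' ?y) (g' ((inv\<^bsub>iso_group M d\<^esub> g') x)) = d ?y ((inv\<^bsub>iso_group M d\<^esub> g') x)"
          by (rule iso_setD(2)[OF g' y y'])
        then show ?thesis using lt y y' iso_group_inv(3)[OF g' x] commute[of x] by simp
      qed
      ultimately show "\<exists>U. openin ?T U \<and> g \<in> U \<and> (\<forall>g'\<in>U. (inv\<^bsub>iso_group M d\<^esub> g') x \<in> mball ?y \<epsilon>)"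
        by blast
    qed
  qed
qed

lemma continuous_action_iso:
  "continuous_action (iso_group M d) (iso_topology M d) mtopology (\<lambda>g x. g x)"
  unfolding continuous_action_def
proof (intro conjI)
  let ?T = "iso_topology M d"
  show "group_action (iso_group M d) (topspace mtopology) (\<lambda>g x. g x)"
    unfolding group_action_def group_hom_def group_hom_axioms_def
    using group_iso_group group_BijGroup iso_set_Bij
    by (auto simp: hom_def carrier_iso_group iso_group_mult BijGroup_def)
  show "continuous_map (prod_topology ?T mtopology) mtopology (\<lambda>(g, x). g x)"
    unfolding continuous_map_to_metric
  proof (intro ballI allI impI)
    fix p \<epsilon> assume "p \<in> topspace (prod_topology ?T mtopology)" and \<epsilon>: "0 < (\<epsilon> :: real)"
    then obtain g x where p: "p = (g, x)" and g: "g \<in> iso_set M d" and x: "x \<in> M"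
      by (auto simp: topspace_iso_topology)
    let ?U = "{g' \<in> iso_set M d. d (g x) (g' x) < \<epsilon> / 2}"
    have gx: "g x \<in> M" using iso_setD(1)[OF g x] .
    have "openin (prod_topology ?T mtopology) (?U \<times> mball x (\<epsilon> / 2))"
      using openin_iso_near_point[OF x gx] openin_mball unfolding openin_prod_Times_iff by blast
    moreover have "p \<in> ?U \<times> mball x (\<epsilon> / 2)" using p g x gx \<epsilon> by simp
    moreover have "(case q of (g, x) \<Rightarrow> g x) \<in> mball (case p of (g, x) \<Rightarrow> g x) \<epsilon>"
      if "q \<in> ?U \<times> mball x (\<epsilon> / 2)" for q
    proof -
      obtain g' x' where q: "q = (g', x')" by (cases q)
      then have g': "g' \<in> iso_set M d" and x': "x' \<in> M" and lt: "d (g x) (g' x) < \<epsilon> / 2" "d x x' < \<epsilon> / 2"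
        using that by auto
      have M': "g' x \<in> M" "g' x' \<in> M" using iso_setD(1)[OF g'] x x' by auto
      have "d (g x) (g' x') < \<epsilon>"
        using triangle[OF gx M'] iso_setD(2)[OF g' x x'] lt by simp
      then show ?thesis using gx M' by (simp add: p q)
    qed
    ultimately show "\<exists>U. openin (prod_topology ?T mtopology) U \<and> p \<in> U \<and>
        (\<forall>q\<in>U. (case q of (g, x) \<Rightarrow> g x) \<in> mball (case p of (g, x) \<Rightarrow> g x) \<epsilon>)"
      by (intro exI[of _ "?U \<times> mball x (\<epsilon> / 2)"]) blast
  qed
qed

lemma nhdsin_iso_topology:
  assumes g: "g \<in> iso_set M d"
  shows "nhdsin (iso_topology M d) g = iso_nhds M d g"
  unfolding filter_eq_iff
proof
  fix P
  show "eventually P (nhdsin (iso_topology M d) g) = eventually P (iso_nhds M d g)"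
  proof
    assume "eventually P (nhdsin (iso_topology M d) g)"
    then obtain O' where O': "openin (iso_topology M d) O'" "g \<in> O'" "\<And>h. h \<in> O' \<Longrightarrow> P h"
      unfolding eventually_nhdsin using g topspace_iso_topology by auto
    then obtain O1 where O1: "openin (product_topology (\<lambda>_. mtopology) M) O1" "O' = O1 \<inter> iso_set M d"
      by (auto simp: iso_topology_def openin_subtopology)
    then obtain U where U: "finite {i \<in> M. U i \<noteq> M}" "\<And>i. i \<in> M \<Longrightarrow> openin mtopology (U i)"
      "g \<in> PiE M U" "PiE M U \<subseteq> O1"
      using O' unfolding openin_product_topology_alt by force
    define A where "A = {i \<in> M. U i \<noteq> M}"
    have "\<exists>r>0. mball (g a) r \<subseteq> U a" if "a \<in> M" for a
      using U(2)[OF that] U(3) that unfolding openin_mtopology by (blast dest: PiE_mem)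
    then obtain r where r: "\<And>a. a \<in> M \<Longrightarrow> 0 < r a \<and> mball (g a) (r a) \<subseteq> U a" by metis
    \<comment> \<open>Inserting 1 keeps \<open>Min\<close> meaningful when no coordinate is
      constrained.\<close>
    define \<epsilon> where "\<epsilon> = Min (insert 1 (r ` A))"
    have fA: "finite A" "A \<subseteq> M" using U(1) by (auto simp: A_def)
    have \<epsilon>: "0 < \<epsilon>" "\<And>a. a \<in> A \<Longrightarrow> \<epsilon> \<le> r a" using fA r by (auto simp: \<epsilon>_def)
    have "P h" if h: "h \<in> iso_near M d g A \<epsilon>" for h
    proof -
      have hi: "h \<in> iso_set M d" using h by (simp add: iso_near_def)
      have "h a \<in> U a" if a: "a \<in> M" for a
      proof (cases "a \<in> A")
        case True
        then have "d (g a) (h a) < r a" using h \<epsilon>(2)[of a] commute[of "g a"] by (force simp: iso_near_def)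
        then have "h a \<in> mball (g a) (r a)" using iso_setD(1)[OF hi a] iso_setD(1)[OF g a] by simp
        then show ?thesis using r[OF a] by blast
      next
        case False
        then show ?thesis using iso_setD(1)[OF hi a] a by (simp add: A_def)
      qed
      then have "h \<in> PiE M U" using iso_setD(4)[OF hi] by (simp add: PiE_iff)
      then show ?thesis using O' O1 U(4) hi by blast
    qed
    then show "eventually P (iso_nhds M d g)" unfolding eventually_iso_nhds using fA \<epsilon>(1) by blast
  next
    assume "eventually P (iso_nhds M d g)"
    then obtain A \<epsilon> where A: "finite A" "A \<subseteq> M" "0 < \<epsilon>" and P: "\<And>h. h \<in> iso_near M d g A \<epsilon> \<Longrightarrow> P h"
      unfolding eventually_iso_nhds by blast
    let ?O = "iso_set M d \<inter> (\<Inter>a\<in>A. {h \<in> iso_set M d. d (g a) (h a) < \<epsilon>})"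
    have "openin (iso_topology M d) ?O"
    proof (cases "A = {}")
      case True
      then show ?thesis using openin_topspace[of "iso_topology M d"] by (simp add: topspace_iso_topology)
    next
      case False
      have "openin (iso_topology M d) (\<Inter>a\<in>A. {h \<in> iso_set M d. d (g a) (h a) < \<epsilon>})"
        using A False iso_setD(1)[OF g] by (intro openin_INT2 openin_iso_near_point) auto
      moreover have "openin (iso_topology M d) (iso_set M d)"
        using openin_topspace[of "iso_topology M d"] by (simp add: topspace_iso_topology)
      ultimately show ?thesis by blast
    qed
    moreover have "g \<in> ?O" using g A iso_setD(1)[OF g] by auto
    moreover have "P h" if "h \<in> ?O" for h
      using that commute by (intro P) (auto simp: iso_near_def)
    ultimately show "eventually P (nhdsin (iso_topology M d) g)"
      unfolding eventually_nhdsin by blast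
  qed
qed

text \<open>The inverse of \<open>g\<close> is an isometry, so its product with \<open>h\<close>
  moves \<open>a\<close> exactly as far as \<open>h a\<close> is from \<open>g a\<close>. The left
  uniformity is thus that of pointwise convergence, and its completion consists of pointwise
  limits.\<close>

lemma eventually_left_uniformity_iso:
  "eventually P (left_uniformity (iso_group M d) (iso_topology M d)) \<longleftrightarrow>
     (\<exists>A \<epsilon>. finite A \<and> A \<subseteq> M \<and> 0 < \<epsilon> \<and> (\<forall>g\<in>iso_set M d. \<forall>h\<in>iso_near M d g A \<epsilon>. P (g, h)))"
proof -
  let ?G = "iso_group M d"
  have one: "\<one>\<^bsub>?G\<^esub> \<in> iso_set M d"
    using monoid.one_closed[OF group.is_monoid[OF group_iso_group]] carrier_iso_group by simp
  have key: "inv\<^bsub>?G\<^esub> g \<otimes>\<^bsub>?G\<^esub> h \<in> iso_near M d \<one>\<^bsub>?G\<^esub> A \<epsilon> \<longleftrightarrow> h \<in> iso_near M d g A \<epsilon>"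
    if g: "g \<in> iso_set M d" and h: "h \<in> iso_set M d" and A: "A \<subseteq> M" for g h A \<epsilon>
  proof -
    have "d ((inv\<^bsub>?G\<^esub> g \<otimes>\<^bsub>?G\<^esub> h) a) (\<one>\<^bsub>?G\<^esub> a) = d (h a) (g a)" if a: "a \<in> M" for a
    proof -
      have "d (h a) (g a) = d ((inv\<^bsub>?G\<^esub> g) (h a)) ((inv\<^bsub>?G\<^esub> g) (g a))"
        using iso_setD(2)[OF iso_group_inv(1)[OF g]] iso_setD(1)[OF g a] iso_setD(1)[OF h a] by simp
      also have "\<dots> = d ((inv\<^bsub>?G\<^esub> g \<otimes>\<^bsub>?G\<^esub> h) a) (\<one>\<^bsub>?G\<^esub> a)"
        using iso_group_inv(2)[OF g a] iso_group_mult_apply[OF iso_group_inv(1)[OF g] h a] a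
        by (simp add: iso_group_one)
      finally show ?thesis by simp
    qed
    then have "\<forall>a\<in>A. d ((inv\<^bsub>?G\<^esub> g \<otimes>\<^bsub>?G\<^esub> h) a) (\<one>\<^bsub>?G\<^esub> a) = d (h a) (g a)" using A by blast
    then show ?thesis
      using h iso_group_mult_closed[OF iso_group_inv(1)[OF g] h] by (simp add: iso_near_def)
  qed
  show ?thesis
  proof
    assume "eventually P (left_uniformity ?G (iso_topology M d))"
    then obtain Q where Q: "eventually Q (iso_nhds M d \<one>\<^bsub>?G\<^esub>)"
      "\<And>g h. Q (inv\<^bsub>?G\<^esub> g \<otimes>\<^bsub>?G\<^esub> h) \<Longrightarrow> g \<in> iso_set M d \<Longrightarrow> h \<in> iso_set M d \<Longrightarrow> P (g, h)"
      unfolding left_uniformity_def eventually_inf_principal eventually_filtercomap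
        nhdsin_iso_topology[OF one] carrier_iso_group by auto
    obtain A \<epsilon> where A: "finite A" "A \<subseteq> M" "0 < \<epsilon>" and QA: "\<And>h. h \<in> iso_near M d \<one>\<^bsub>?G\<^esub> A \<epsilon> \<Longrightarrow> Q h"
      using Q(1) unfolding eventually_iso_nhds by blast
    have "P (g, h)" if g: "g \<in> iso_set M d" and h: "h \<in> iso_near M d g A \<epsilon>" for g h
    proof -
      have "h \<in> iso_set M d" using h by (simp add: iso_near_def)
      then show ?thesis using Q(2)[OF QA] key[OF g _ A(2)] g h by blast
    qed
    then show "\<exists>A \<epsilon>. finite A \<and> A \<subseteq> M \<and> 0 < \<epsilon> \<and> (\<forall>g\<in>iso_set M d. \<forall>h\<in>iso_near M d g A \<epsilon>. P (g, h))"
      using A by blast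
  next
    assume "\<exists>A \<epsilon>. finite A \<and> A \<subseteq> M \<and> 0 < \<epsilon> \<and> (\<forall>g\<in>iso_set M d. \<forall>h\<in>iso_near M d g A \<epsilon>. P (g, h))"
    then obtain A \<epsilon> where A: "finite A" "A \<subseteq> M" "0 < \<epsilon>"
      and P: "\<And>g h. g \<in> iso_set M d \<Longrightarrow> h \<in> iso_near M d g A \<epsilon> \<Longrightarrow> P (g, h)" by blast
    have "eventually (\<lambda>h. h \<in> iso_near M d \<one>\<^bsub>?G\<^esub> A \<epsilon>) (iso_nhds M d \<one>\<^bsub>?G\<^esub>)"
      by (rule iso_nhds_near[OF A])
    moreover have "P (g, h)" if "inv\<^bsub>?G\<^esub> g \<otimes>\<^bsub>?G\<^esub> h \<in> iso_near M d \<one>\<^bsub>?G\<^esub> A \<epsilon>" "g \<in> iso_set M d" "h \<in> iso_set M d" for g h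
      using P key[OF that(2,3) A(2)] that by blast
    ultimately show "eventually P (left_uniformity ?G (iso_topology M d))"
      unfolding left_uniformity_def eventually_inf_principal eventually_filtercomap
        nhdsin_iso_topology[OF one] carrier_iso_group by auto
  qed
qed

end

section \<open>The left completion of the isometry group\<close>

lemma ultrahomogeneous_extend:
  assumes S: "urysohn_sphere S d" and A: "finite A" "A \<subseteq> S"
    and p: "\<And>a. a \<in> A \<Longrightarrow> p a \<in> S" "\<And>a b. a \<in> A \<Longrightarrow> b \<in> A \<Longrightarrow> d (p a) (p b) = d a b"
  obtains g where "g \<in> iso_set S d" "\<forall>a\<in>A. g a = p a"
proof -
  have "isometry_onto A d (p ` A) d p"
    using p by (auto simp: isometry_onto_def isometric_embedding_def)
  moreover have "finite (p ` A)" "p ` A \<subseteq> S" using A p by auto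
  ultimately obtain g where g: "isometry_onto S d S d g" "\<forall>a\<in>A. g a = p a"
    using urysohn_sphereD(4)[OF S, unfolded ultrahomogeneous_def, rule_format, of A "p ` A" p] A(1,2) by auto
  have "restrict g S \<in> iso_set S d"
    using g(1) by (auto simp: iso_set_def isometry_onto_def isometric_embedding_def)
  moreover have "\<forall>a\<in>A. restrict g S a = p a" using g(2) A by auto
  ultimately show ?thesis by (rule that)
qed

text \<open>Some isometry is close to both maps at \<open>x\<close>, which is the Hausdorff property
  of pointwise limits. Consequently a point of the completion determines its embedding on
  \<open>M\<close>.\<close>

lemma (in Metric_space) iso_nhds_unique:
  assumes F: "F \<noteq> bot" "F \<le> iso_nhds M d \<phi>" "F \<le> iso_nhds M d \<psi>"
    and \<phi>\<psi>: "isometric_embedding M d M d \<phi>" "isometric_embedding M d M d \<psi>" and x: "x \<in> M"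
  shows "\<phi> x = \<psi> x"
proof -
  have M: "\<phi> x \<in> M" "\<psi> x \<in> M" using \<phi>\<psi> x by (auto simp: isometric_embedding_def)
  have "d (\<phi> x) (\<psi> x) \<le> 0 + \<epsilon>" if "0 < \<epsilon>" for \<epsilon>
  proof -
    have "eventually (\<lambda>g. g \<in> iso_near M d \<phi> {x} (\<epsilon> / 2)) F"
      by (rule filter_leD[OF F(2) iso_nhds_near]) (use that x in auto)
    moreover have "eventually (\<lambda>g. g \<in> iso_near M d \<psi> {x} (\<epsilon> / 2)) F"
      by (rule filter_leD[OF F(3) iso_nhds_near]) (use that x in auto)
    ultimately have "eventually (\<lambda>g. g \<in> iso_near M d \<phi> {x} (\<epsilon> / 2) \<and> g \<in> iso_near M d \<psi> {x} (\<epsilon> / 2)) F"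
      by (rule eventually_conj)
    then obtain g where g: "g \<in> iso_near M d \<phi> {x} (\<epsilon> / 2)" "g \<in> iso_near M d \<psi> {x} (\<epsilon> / 2)"
      using eventually_happens'[OF F(1)] by blast
    then have "g x \<in> M" using iso_setD(1)[of g x] x by (simp add: iso_near_def)
    then show ?thesis using triangle[OF M(1) _ M(2), of "g x"] g commute[of "\<phi> x" "g x"] by (simp add: iso_near_def)
  qed
  then have "d (\<phi> x) (\<psi> x) \<le> 0" by (rule field_le_epsilon)
  then show ?thesis using M nonneg[of "\<phi> x" "\<psi> x"] zero[OF M] by linarith
qed

text \<open>By ultrahomogeneity an embedding agrees on each finite set with an isometry onto; so the
  group is pointwise dense among the self-embeddings.\<close>

lemma iso_nhds_not_bot:
  assumes S: "urysohn_sphere S d" and \<phi>: "isometric_embedding S d S d \<phi>"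
  shows "iso_nhds S d \<phi> \<noteq> bot"
proof
  interpret Metric_space S d using urysohn_sphereD(1)[OF S] .
  assume "iso_nhds S d \<phi> = bot"
  then have "eventually (\<lambda>_. False) (iso_nhds S d \<phi>)" by simp
  then obtain A \<epsilon> where A: "finite A" "A \<subseteq> S" "0 < (\<epsilon> :: real)" "iso_near S d \<phi> A \<epsilon> = {}"
    unfolding eventually_iso_nhds by blast
  have \<phi>S: "\<phi> a \<in> S" if "a \<in> S" for a using \<phi> that by (auto simp: isometric_embedding_def)
  obtain g where g: "g \<in> iso_set S d" "\<forall>a\<in>A. g a = \<phi> a"
  proof (rule ultrahomogeneous_extend[OF S A(1,2), of \<phi>])
    show "d (\<phi> a) (\<phi> b) = d a b" if "a \<in> A" "b \<in> A" for a b
      using \<phi> that A(2) by (auto simp: isometric_embedding_def)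
  qed (use \<phi>S A(2) in auto)
  have "d (g a) (\<phi> a) < \<epsilon>" if "a \<in> A" for a
    using g(2) that \<phi>S[of a] A by auto
  then have "g \<in> iso_near S d \<phi> A \<epsilon>" using g(1) by (simp add: iso_near_def)
  then show False using A(4) by blast
qed

lemma cauchy_iso_nhds:
  assumes S: "urysohn_sphere S d" and \<phi>: "isometric_embedding S d S d \<phi>"
  shows "cauchy_filter_in (iso_set S d) (left_uniformity (iso_group S d) (iso_topology S d)) (iso_nhds S d \<phi>)"
  unfolding cauchy_filter_in_def
proof (intro conjI iso_nhds_not_bot[OF S \<phi>] iso_nhds_le_principal filter_leI)
  interpret Metric_space S d using urysohn_sphereD(1)[OF S] .
  fix P assume "eventually P (left_uniformity (iso_group S d) (iso_topology S d))"
  then obtain A \<epsilon> where A: "finite A" "A \<subseteq> S" "0 < \<epsilon>"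
    and P: "\<And>g h. g \<in> iso_set S d \<Longrightarrow> h \<in> iso_near S d g A \<epsilon> \<Longrightarrow> P (g, h)"
    unfolding eventually_left_uniformity_iso by blast
  have "P (g, h)" if g: "g \<in> iso_near S d \<phi> A (\<epsilon> / 2)" and h: "h \<in> iso_near S d \<phi> A (\<epsilon> / 2)" for g h
  proof (rule P)
    show gi: "g \<in> iso_set S d" using g by (simp add: iso_near_def)
    have hi: "h \<in> iso_set S d" using h by (simp add: iso_near_def)
    have "d (h a) (g a) < \<epsilon>" if a: "a \<in> A" for a
    proof -
      have aS: "a \<in> S" using a A by blast
      have "\<phi> a \<in> S" using \<phi> aS by (auto simp: isometric_embedding_def)
      then have "d (h a) (g a) \<le> d (h a) (\<phi> a) + d (g a) (\<phi> a)"
        using triangle[OF iso_setD(1)[OF hi aS] _ iso_setD(1)[OF gi aS]] commute by metis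
      moreover have "d (h a) (\<phi> a) < \<epsilon> / 2" "d (g a) (\<phi> a) < \<epsilon> / 2"
        using g h a by (auto simp: iso_near_def)
      ultimately show ?thesis by simp
    qed
    then show "h \<in> iso_near S d g A \<epsilon>" using hi by (simp add: iso_near_def)
  qed
  moreover have "eventually (\<lambda>g. g \<in> iso_near S d \<phi> A (\<epsilon> / 2)) (iso_nhds S d \<phi>)"
    using A by (intro iso_nhds_near) auto
  ultimately show "eventually P (iso_nhds S d \<phi> \<times>\<^sub>F iso_nhds S d \<phi>)"
    unfolding eventually_prod_same by blast
qed

text \<open>Completeness gives a limit at each point. The limit map inherits the preservation of
  distances, but it may fail to be onto.\<close>

lemma cauchy_filter_in_iso_limit:
  assumes S: "urysohn_sphere S d"
    and F: "cauchy_filter_in (iso_set S d) (left_uniformity (iso_group S d) (iso_topology S d)) F"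
  obtains \<phi> where "isometric_embedding S d S d \<phi>" "F \<le> iso_nhds S d \<phi>"
proof -
  interpret Metric_space S d using urysohn_sphereD(1)[OF S] .
  have F': "F \<noteq> bot" "F \<le> principal (iso_set S d)"
    "F \<times>\<^sub>F F \<le> left_uniformity (iso_group S d) (iso_topology S d)"
    using F by (auto simp: cauchy_filter_in_def)
  have Fi: "eventually (\<lambda>g. g \<in> iso_set S d) F" using F'(2) by (simp add: le_principal)
  have "\<exists>l\<in>S. \<forall>\<epsilon>>0. eventually (\<lambda>h. d (h a) l < \<epsilon>) F" if a: "a \<in> S" for a
  proof -
    \<comment> \<open>Countably many centres replace the filter by a Cauchy sequence at
      \<open>a\<close>, to which sequential completeness applies.\<close>
    have "\<exists>g\<in>iso_set S d. eventually (\<lambda>h. d (h a) (g a) < 1 / real (Suc n)) F" for n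
    proof -
      have "eventually (\<lambda>(g, h). h \<in> iso_near S d g {a} (1 / real (Suc n)))
          (left_uniformity (iso_group S d) (iso_topology S d))"
        unfolding eventually_left_uniformity_iso using a
        by (intro exI[of _ "{a}"] exI[of _ "1 / real (Suc n)"]) simp
      then have "eventually (\<lambda>(g, h). h \<in> iso_near S d g {a} (1 / real (Suc n))) (F \<times>\<^sub>F F)"
        by (rule filter_leD[OF F'(3)])
      then obtain Q where Q: "eventually Q F" "\<And>g h. Q g \<Longrightarrow> Q h \<Longrightarrow> h \<in> iso_near S d g {a} (1 / real (Suc n))"
        unfolding eventually_prod_same by auto
      have "eventually (\<lambda>g. Q g \<and> g \<in> iso_set S d) F" using Q(1) Fi by (rule eventually_conj)
      then obtain g where g: "Q g" "g \<in> iso_set S d" using eventually_happens'[OF F'(1)] by blast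
      have "eventually (\<lambda>h. d (h a) (g a) < 1 / real (Suc n)) F"
        using Q(1) by (rule eventually_mono) (use Q(2)[OF g(1)] in \<open>auto simp: iso_near_def\<close>)
      then show ?thesis using g(2) by blast
    qed
    then obtain g where g: "\<And>n. g n \<in> iso_set S d"
      "\<And>n. eventually (\<lambda>h. d (h a) (g n a) < 1 / real (Suc n)) F" by metis
    have ga: "g n a \<in> S" for n using iso_setD(1)[OF g(1) a] .
    have gg: "d (g m a) (g n a) < 1 / real (Suc m) + 1 / real (Suc n)" for m n
    proof -
      have "eventually (\<lambda>h. h \<in> iso_set S d \<and> d (h a) (g m a) < 1 / real (Suc m) \<and> d (h a) (g n a) < 1 / real (Suc n)) F"
        by (intro eventually_conj Fi g(2))
      then obtain h where h: "h \<in> iso_set S d" "d (h a) (g m a) < 1 / real (Suc m)" "d (h a) (g n a) < 1 / real (Suc n)"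
        using eventually_happens'[OF F'(1)] by blast
      have "d (g m a) (g n a) \<le> d (g m a) (h a) + d (h a) (g n a)"
        by (rule triangle[OF ga iso_setD(1)[OF h(1) a] ga])
      then show ?thesis using h(2,3) commute[of "g m a" "h a"] by linarith
    qed
    have small: "\<exists>N. \<forall>n\<ge>N. 1 / real (Suc n) < \<epsilon>" if "0 < \<epsilon>" for \<epsilon> :: real
      using order_tendstoD(2)[OF LIMSEQ_inverse_real_of_nat that]
      by (simp add: eventually_sequentially inverse_eq_divide)
    have "MCauchy (\<lambda>n. g n a)"
      unfolding MCauchy_def
    proof (intro conjI allI impI)
      show "range (\<lambda>n. g n a) \<subseteq> S" using ga by blast
      fix \<epsilon> :: real assume "0 < \<epsilon>"
      then obtain N where N: "\<And>n. n \<ge> N \<Longrightarrow> 1 / real (Suc n) < \<epsilon> / 2" using small[of "\<epsilon> / 2"] by auto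
      have "d (g n a) (g n' a) < \<epsilon>" if "N \<le> n" "N \<le> n'" for n n'
        using gg[of n n'] N[OF that(1)] N[OF that(2)] by linarith
      then show "\<exists>N. \<forall>n n'. N \<le> n \<longrightarrow> N \<le> n' \<longrightarrow> d (g n a) (g n' a) < \<epsilon>" by blast
    qed
    then obtain l where l: "limitin mtopology (\<lambda>n. g n a) l sequentially"
      using urysohn_sphereD(2)[OF S] by (auto simp: mcomplete_def)
    then have lS: "l \<in> S" and l0: "\<And>\<epsilon>. 0 < \<epsilon> \<Longrightarrow> eventually (\<lambda>n. d (g n a) l < \<epsilon>) sequentially"
      by (auto simp: limitin_metric elim: eventually_mono)
    have "eventually (\<lambda>h. d (h a) l < \<epsilon>) F" if \<epsilon>: "0 < \<epsilon>" for \<epsilon>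
    proof -
      obtain N where N: "\<And>n. n \<ge> N \<Longrightarrow> 1 / real (Suc n) < \<epsilon> / 2" using small[of "\<epsilon> / 2"] \<epsilon> by auto
      obtain N' where N': "\<And>n. n \<ge> N' \<Longrightarrow> d (g n a) l < \<epsilon> / 2"
        using l0[of "\<epsilon> / 2"] \<epsilon> by (auto simp: eventually_sequentially)
      define n where "n = max N N'"
      have "eventually (\<lambda>h. h \<in> iso_set S d \<and> d (h a) (g n a) < 1 / real (Suc n)) F"
        by (intro eventually_conj Fi g(2))
      then show ?thesis
      proof (rule eventually_mono)
        fix h assume h: "h \<in> iso_set S d \<and> d (h a) (g n a) < 1 / real (Suc n)"
        then have "d (h a) l \<le> d (h a) (g n a) + d (g n a) l"
          using triangle[OF _ ga lS] iso_setD(1)[of h a] a by blast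
        then show "d (h a) l < \<epsilon>" using h N[of n] N'[of n] by (simp add: n_def)
      qed
    qed
    then show ?thesis using lS by blast
  qed
  then have "\<exists>\<phi>. \<forall>a\<in>S. \<phi> a \<in> S \<and> (\<forall>\<epsilon>>0. eventually (\<lambda>h. d (h a) (\<phi> a) < \<epsilon>) F)"
    by (intro bchoice) blast
  then obtain \<phi> where \<phi>': "\<forall>a\<in>S. \<phi> a \<in> S \<and> (\<forall>\<epsilon>>0. eventually (\<lambda>h. d (h a) (\<phi> a) < \<epsilon>) F)" ..
  then have \<phi>: "\<And>a. a \<in> S \<Longrightarrow> \<phi> a \<in> S"
    "\<And>a \<epsilon>. a \<in> S \<Longrightarrow> 0 < \<epsilon> \<Longrightarrow> eventually (\<lambda>h. d (h a) (\<phi> a) < \<epsilon>) F"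
    by blast+
  have "d (\<phi> a) (\<phi> b) = d a b" if ab: "a \<in> S" "b \<in> S" for a b
  proof -
    have "\<bar>d (\<phi> a) (\<phi> b) - d a b\<bar> \<le> 0 + \<epsilon>" if \<epsilon>: "0 < \<epsilon>" for \<epsilon>
    proof -
      have "eventually (\<lambda>h. h \<in> iso_set S d \<and> d (h a) (\<phi> a) < \<epsilon> / 2 \<and> d (h b) (\<phi> b) < \<epsilon> / 2) F"
        using ab \<epsilon> by (intro eventually_conj Fi \<phi>(2)) auto
      then obtain h where h: "h \<in> iso_set S d" "d (h a) (\<phi> a) < \<epsilon> / 2" "d (h b) (\<phi> b) < \<epsilon> / 2"
        using eventually_happens'[OF F'(1)] by blast
      have S4: "h a \<in> S" "h b \<in> S" "\<phi> a \<in> S" "\<phi> b \<in> S" using iso_setD(1)[OF h(1)] \<phi>(1) ab by auto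
      have "d (h a) (h b) = d a b" using iso_setD(2)[OF h(1) ab] .
      moreover have "d (h a) (h b) \<le> d (h a) (\<phi> a) + (d (\<phi> a) (\<phi> b) + d (h b) (\<phi> b))"
        using triangle[OF S4(1,3,2)] triangle[OF S4(3,4,2)] commute[of "\<phi> b" "h b"] by linarith
      moreover have "d (\<phi> a) (\<phi> b) \<le> d (h a) (\<phi> a) + (d (h a) (h b) + d (h b) (\<phi> b))"
        using triangle[OF S4(3,1,4)] triangle[OF S4(1,2,4)] commute[of "\<phi> a" "h a"] by linarith
      ultimately show ?thesis using h by linarith
    qed
    then have "\<bar>d (\<phi> a) (\<phi> b) - d a b\<bar> \<le> 0" by (rule field_le_epsilon)
    then show ?thesis by simp
  qed
  then have "isometric_embedding S d S d \<phi>" using \<phi>(1) by (auto simp: isometric_embedding_def)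
  moreover have "F \<le> iso_nhds S d \<phi>"
  proof (rule filter_leI)
    fix P assume "eventually P (iso_nhds S d \<phi>)"
    then obtain A \<epsilon> where A: "finite A" "A \<subseteq> S" "0 < \<epsilon>" and P: "\<And>g. g \<in> iso_near S d \<phi> A \<epsilon> \<Longrightarrow> P g"
      unfolding eventually_iso_nhds by blast
    have "eventually (\<lambda>h. \<forall>a\<in>A. d (h a) (\<phi> a) < \<epsilon>) F"
      by (rule eventually_ball_finite[OF A(1)]) (use \<phi>(2) A in blast)
    with Fi have "eventually (\<lambda>h. h \<in> iso_set S d \<and> (\<forall>a\<in>A. d (h a) (\<phi> a) < \<epsilon>)) F"
      by (rule eventually_conj)
    then show "eventually P F"
      by (rule eventually_mono) (use P in \<open>simp add: iso_near_def\<close>)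
  qed
  ultimately show ?thesis by (rule that)
qed

text \<open>Every Cauchy filter lies below some \<open>iso_nhds\<close>, and two of these with a
  common proper filter below them coincide; hence they are precisely the maximal Cauchy
  filters.\<close>

lemma left_completion_iso:
  assumes S: "urysohn_sphere S d"
  shows "left_completion (iso_group S d) (iso_topology S d) =
    {iso_nhds S d \<phi> | \<phi>. isometric_embedding S d S d \<phi>}"
proof -
  interpret Metric_space S d using urysohn_sphereD(1)[OF S] .
  let ?U = "left_uniformity (iso_group S d) (iso_topology S d)"
  show ?thesis
  proof (intro subset_antisym subsetI)
    fix F assume "F \<in> left_completion (iso_group S d) (iso_topology S d)"
    then have F: "cauchy_filter_in (iso_set S d) ?U F"
      "\<And>F'. cauchy_filter_in (iso_set S d) ?U F' \<Longrightarrow> F \<le> F' \<Longrightarrow> F' = F"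
      by (auto simp: left_completion_def completion_def carrier_iso_group)
    obtain \<phi> where \<phi>: "isometric_embedding S d S d \<phi>" "F \<le> iso_nhds S d \<phi>"
      by (rule cauchy_filter_in_iso_limit[OF S F(1)])
    then show "F \<in> {iso_nhds S d \<phi> | \<phi>. isometric_embedding S d S d \<phi>}"
      using F(2)[OF cauchy_iso_nhds[OF S \<phi>(1)] \<phi>(2)] by blast
  next
    fix F assume "F \<in> {iso_nhds S d \<phi> | \<phi>. isometric_embedding S d S d \<phi>}"
    then obtain \<phi> where \<phi>: "isometric_embedding S d S d \<phi>" "F = iso_nhds S d \<phi>" by blast
    have "F' = F" if F': "cauchy_filter_in (iso_set S d) ?U F'" "F \<le> F'" for F'
    proof -
      obtain \<psi> where \<psi>: "isometric_embedding S d S d \<psi>" "F' \<le> iso_nhds S d \<psi>"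
        by (rule cauchy_filter_in_iso_limit[OF S F'(1)])
      have "F \<le> iso_nhds S d \<psi>" using F'(2) \<psi>(2) by (rule order_trans)
      then have "\<phi> x = \<psi> x" if "x \<in> S" for x
        using iso_nhds_unique[OF iso_nhds_not_bot[OF S \<phi>(1)] order_refl _ \<phi>(1) \<psi>(1) that] \<phi>(2) by simp
      then have "iso_nhds S d \<phi> = iso_nhds S d \<psi>" by (rule iso_nhds_cong)
      then show ?thesis using F'(2) \<psi>(2) \<phi>(2) by simp
    qed
    then show "F \<in> left_completion (iso_group S d) (iso_topology S d)"
      using cauchy_iso_nhds[OF S \<phi>(1)] \<phi>(2)
      by (auto simp: left_completion_def completion_def carrier_iso_group)
  qed
qed

lemma (in Metric_space) completion_embed_iso:
  assumes g: "g \<in> iso_set M d"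
  shows "completion_embed (left_uniformity (iso_group M d) (iso_topology M d)) g = iso_nhds M d g"
  unfolding completion_embed_def filter_eq_iff
proof
  fix P
  let ?U = "left_uniformity (iso_group M d) (iso_topology M d)"
  show "eventually P (filtercomap (Pair g) ?U) = eventually P (iso_nhds M d g)"
  proof
    assume "eventually P (filtercomap (Pair g) ?U)"
    then obtain Q where Q: "eventually Q ?U" "\<And>h. Q (g, h) \<Longrightarrow> P h" unfolding eventually_filtercomap by blast
    then obtain A \<epsilon> where "finite A" "A \<subseteq> M" "0 < \<epsilon>" "\<forall>h\<in>iso_near M d g A \<epsilon>. Q (g, h)"
      unfolding eventually_left_uniformity_iso using g by blast
    then show "eventually P (iso_nhds M d g)" unfolding eventually_iso_nhds using Q(2) by blast
  next
    assume "eventually P (iso_nhds M d g)"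
    then obtain A \<epsilon> where A: "finite A" "A \<subseteq> M" "0 < \<epsilon>" and P: "\<And>h. h \<in> iso_near M d g A \<epsilon> \<Longrightarrow> P h"
      unfolding eventually_iso_nhds by blast
    have "eventually (\<lambda>(g, h). h \<in> iso_near M d g A \<epsilon>) ?U"
      unfolding eventually_left_uniformity_iso using A by blast
    then show "eventually P (filtercomap (Pair g) ?U)" unfolding eventually_filtercomap using P by blast
  qed
qed

lemma left_completion_mult_iso:
  assumes S: "urysohn_sphere S d"
    and \<phi>: "isometric_embedding S d S d \<phi>" and \<psi>: "isometric_embedding S d S d \<psi>"
  shows "left_completion_mult (iso_group S d) (iso_topology S d) (iso_nhds S d \<phi>) (iso_nhds S d \<psi>)
    = iso_nhds S d (\<phi> \<circ> \<psi>)"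
proof -
  interpret Metric_space S d using urysohn_sphereD(1)[OF S] .
  let ?F = "filtermap (\<lambda>(x, y). x \<otimes>\<^bsub>iso_group S d\<^esub> y) (iso_nhds S d \<phi> \<times>\<^sub>F iso_nhds S d \<psi>)"
  have \<phi>S: "\<phi> x \<in> S" if "x \<in> S" for x using \<phi> that by (auto simp: isometric_embedding_def)
  have \<psi>S: "\<psi> x \<in> S" if "x \<in> S" for x using \<psi> that by (auto simp: isometric_embedding_def)
  have comp: "isometric_embedding S d S d (\<phi> \<circ> \<psi>)"
    using \<phi> \<psi> \<psi>S by (auto simp: isometric_embedding_def)
  have le: "?F \<le> iso_nhds S d (\<phi> \<circ> \<psi>)"
  proof (rule filter_leI)
    fix P assume "eventually P (iso_nhds S d (\<phi> \<circ> \<psi>))"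
    then obtain A \<epsilon> where A: "finite A" "A \<subseteq> S" "0 < \<epsilon>" and P: "\<And>g. g \<in> iso_near S d (\<phi> \<circ> \<psi>) A \<epsilon> \<Longrightarrow> P g"
      unfolding eventually_iso_nhds by blast
    have "P (g \<otimes>\<^bsub>iso_group S d\<^esub> h)"
      if g: "g \<in> iso_near S d \<phi> (\<psi> ` A) (\<epsilon> / 2)" and h: "h \<in> iso_near S d \<psi> A (\<epsilon> / 2)" for g h
    proof (rule P)
      have gi: "g \<in> iso_set S d" and hi: "h \<in> iso_set S d" using g h by (auto simp: iso_near_def)
      have "d (g (h a)) (\<phi> (\<psi> a)) < \<epsilon>" if a: "a \<in> A" for a
      proof -
        have aS: "a \<in> S" using a A by blast
        have S3: "g (h a) \<in> S" "g (\<psi> a) \<in> S" "\<phi> (\<psi> a) \<in> S"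
          using iso_setD(1)[OF gi] iso_setD(1)[OF hi] \<phi>S \<psi>S aS by auto
        have "d (g (h a)) (g (\<psi> a)) = d (h a) (\<psi> a)"
          by (rule iso_setD(2)[OF gi iso_setD(1)[OF hi aS] \<psi>S[OF aS]])
        moreover have "d (h a) (\<psi> a) < \<epsilon> / 2" "d (g (\<psi> a)) (\<phi> (\<psi> a)) < \<epsilon> / 2"
          using g h a by (auto simp: iso_near_def)
        ultimately show ?thesis using triangle[OF S3] by linarith
      qed
      then show "g \<otimes>\<^bsub>iso_group S d\<^esub> h \<in> iso_near S d (\<phi> \<circ> \<psi>) A \<epsilon>"
        using iso_group_mult_closed[OF gi hi] iso_group_mult_apply[OF gi hi] A(2)
        by (auto simp: iso_near_def subset_iff)
    qed
    moreover have "eventually (\<lambda>g. g \<in> iso_near S d \<phi> (\<psi> ` A) (\<epsilon> / 2)) (iso_nhds S d \<phi>)"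
      using A \<psi>S by (intro iso_nhds_near) auto
    moreover have "eventually (\<lambda>h. h \<in> iso_near S d \<psi> A (\<epsilon> / 2)) (iso_nhds S d \<psi>)"
      using A by (intro iso_nhds_near) auto
    ultimately show "eventually P ?F"
      unfolding eventually_filtermap eventually_prod_filter prod.case by blast
  qed
  have bot: "?F \<noteq> bot"
    using iso_nhds_not_bot[OF S \<phi>] iso_nhds_not_bot[OF S \<psi>]
    by (simp add: filtermap_bot_iff prod_filter_eq_bot)
  have "(THE H. H \<in> left_completion (iso_group S d) (iso_topology S d) \<and> ?F \<le> H) = iso_nhds S d (\<phi> \<circ> \<psi>)"
  proof (rule the_equality)
    show "iso_nhds S d (\<phi> \<circ> \<psi>) \<in> left_completion (iso_group S d) (iso_topology S d)
        \<and> ?F \<le> iso_nhds S d (\<phi> \<circ> \<psi>)"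
      unfolding left_completion_iso[OF S] using comp le by blast
    fix H assume "H \<in> left_completion (iso_group S d) (iso_topology S d) \<and> ?F \<le> H"
    then obtain \<eta> where \<eta>: "isometric_embedding S d S d \<eta>" "H = iso_nhds S d \<eta>" "?F \<le> H"
      unfolding left_completion_iso[OF S] by blast
    have "\<eta> x = (\<phi> \<circ> \<psi>) x" if "x \<in> S" for x
      using iso_nhds_unique[OF bot _ le \<eta>(1) comp that] \<eta>(2,3) by simp
    then show "H = iso_nhds S d (\<phi> \<circ> \<psi>)" unfolding \<eta>(2) by (rule iso_nhds_cong)
  qed
  then show ?thesis
    unfolding left_completion_mult_def completion_lim_def left_completion_def .
qed

section \<open>Oscillation stability\<close>

lemma uniformly_continuous_wrt_real_iff:
  fixes f :: "'g \<Rightarrow> real"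
  shows "uniformly_continuous_wrt U f \<longleftrightarrow> (\<forall>\<eta>>0. eventually (\<lambda>(x, y). \<bar>f x - f y\<bar> < \<eta>) U)"
  unfolding uniformly_continuous_wrt_def uniformity_dist filterlim_INF filterlim_principal
  by (simp add: case_prod_unfold dist_real_def Ball_def)

lemma min_one_triangle: "a \<le> b + c \<Longrightarrow> 0 \<le> b \<Longrightarrow> 0 \<le> c \<Longrightarrow> min 1 a \<le> min 1 b + min 1 c" for a b c :: real
  by linarith

text \<open>Embed a finite set containing \<open>x\<close> times a two-point space of diameter \<open>d u v\<close>, with the two
  copies of \<open>x\<close> at \<open>u\<close> and \<open>v\<close>.\<close>

lemma displaced_isometries:
  assumes S: "urysohn_sphere S d" and A: "finite A" "A \<subseteq> S" "x \<in> S" and uv: "u \<in> S" "v \<in> S"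
  obtains g h where "g \<in> iso_set S d" "h \<in> iso_set S d" "g x = u" "h x = v" "\<forall>a\<in>A. d (h a) (g a) = d u v"
proof -
  interpret Metric_space S d using urysohn_sphereD(1)[OF S] .
  define B where "B = insert x A"
  have B: "finite B" "B \<subseteq> S" "x \<in> B" using A by (auto simp: B_def)
  define t where "t = d u v"
  have t: "0 \<le> t" "t \<le> 1" using urysohn_sphereD(5)[OF S uv] by (simp_all add: t_def)
  \<comment> \<open>The sum metric of the product, cut off at the diameter 1 of the sphere.\<close>
  define \<delta> where "\<delta> p q = min 1 (d (fst p) (fst q) + (if snd p = snd q then 0 else t))"
    for p q :: "'a \<times> bool"
  define V where "V = B \<times> (UNIV :: bool set)"
  have "pseudometric_on V \<delta>"
    unfolding pseudometric_on_def
  proof (intro conjI ballI)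
    show "\<delta> p p = 0" if "p \<in> V" for p using that B by (auto simp: \<delta>_def V_def)
    show "\<delta> p q = \<delta> q p" for p q by (simp add: \<delta>_def commute)
    show "\<delta> p r \<le> \<delta> p q + \<delta> q r" if "p \<in> V" "q \<in> V" "r \<in> V" for p q r
    proof -
      have "fst p \<in> S" "fst q \<in> S" "fst r \<in> S" using that B by (auto simp: V_def)
      then have "d (fst p) (fst r) \<le> d (fst p) (fst q) + d (fst q) (fst r)" by (rule triangle)
      moreover have "0 \<le> d (fst p) (fst q)" "0 \<le> d (fst q) (fst r)" by simp_all
      ultimately show ?thesis using t unfolding \<delta>_def by (intro min_one_triangle) auto
    qed
  qed
  moreover have "countable V" "V \<noteq> {}" "\<delta> p q \<le> 1" for p q
    using B by (auto simp: V_def \<delta>_def intro: countable_finite)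
  ultimately obtain e where e: "\<forall>p\<in>V. e p \<in> S" "\<forall>p\<in>V. \<forall>q\<in>V. d (e p) (e q) = \<delta> p q"
    using urysohn_embed_countable[OF S, of V \<delta>] by blast
  have VB: "(b, i) \<in> V" if "b \<in> B" for b i using that by (simp add: V_def)
  have eS: "e (b, i) \<in> S" if "b \<in> B" for b i using e(1) VB[OF that] by blast
  have ed: "d (e (b, i)) (e (c, j)) = \<delta> (b, i) (c, j)" if "b \<in> B" "c \<in> B" for b c i j
    using e(2) VB[OF that(1)] VB[OF that(2)] by blast
  let ?C = "{e (x, False), e (x, True)}"
  have d01: "d (e (x, False)) (e (x, True)) = t"
    using ed[OF B(3) B(3)] B t by (auto simp: \<delta>_def)
  \<comment> \<open>If the two copies of \<open>x\<close> coincide, then \<open>t = 0\<close> and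
    \<open>u = v\<close>, so \<open>p\<close> is still correct on both.\<close>
  define p where "p y = (if y = e (x, False) then u else v)" for y
  have p: "p (e (x, False)) = u" "p (e (x, True)) = v"
  proof -
    show "p (e (x, False)) = u" by (simp add: p_def)
    show "p (e (x, True)) = v"
    proof (cases "e (x, True) = e (x, False)")
      case True
      then have "t = 0" using d01 eS[OF B(3)] by simp
      then show ?thesis using True uv by (simp add: p_def t_def)
    qed (simp add: p_def)
  qed
  \<comment> \<open>\<open>\<theta>\<close> puts the two copies of \<open>x\<close> at
    \<open>u\<close> and \<open>v\<close>. Afterwards each copy of \<open>B\<close> is the image of
    \<open>B\<close> under an isometry, one giving \<open>g\<close> and the other
    \<open>h\<close>.\<close>
  obtain \<theta> where \<theta>: "\<theta> \<in> iso_set S d" "\<forall>y\<in>?C. \<theta> y = p y"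
  proof (rule ultrahomogeneous_extend[OF S, of ?C p])
    show "?C \<subseteq> S" using eS[OF B(3)] by simp
    show "p a \<in> S" for a using uv by (simp add: p_def)
    show "d (p a) (p b) = d a b" if "a \<in> ?C" "b \<in> ?C" for a b
    proof -
      have 1: "d (p (e (x, False))) (p (e (x, True))) = d (e (x, False)) (e (x, True))"
        by (simp only: p d01 t_def)
      then have 2: "d (p (e (x, True))) (p (e (x, False))) = d (e (x, True)) (e (x, False))"
        by (metis commute)
      have 3: "d (p (e (x, i))) (p (e (x, i))) = d (e (x, i)) (e (x, i))" for i
        using uv eS[OF B(3), of i] by (simp add: p_def)
      from that consider "a = e (x, False)" "b = e (x, False)" | "a = e (x, False)" "b = e (x, True)"
        | "a = e (x, True)" "b = e (x, False)" | "a = e (x, True)" "b = e (x, True)" by blast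
      then show ?thesis by cases (simp_all only: 1 2 3)
    qed
  qed auto
  have \<theta>S: "\<theta> (e (b, i)) \<in> S" if "b \<in> B" for b i using iso_setD(1)[OF \<theta>(1) eS[OF that]] .
  have \<theta>d: "d (\<theta> (e (b, i))) (\<theta> (e (c, j))) = \<delta> (b, i) (c, j)" if "b \<in> B" "c \<in> B" for b c i j
    using iso_setD(2)[OF \<theta>(1) eS[OF that(1)] eS[OF that(2)]] ed[OF that] by simp
  have ex: "\<exists>g\<in>iso_set S d. \<forall>b\<in>B. g b = \<theta> (e (b, i))" for i
  proof -
    obtain g where "g \<in> iso_set S d" "\<forall>b\<in>B. g b = \<theta> (e (b, i))"
    proof (rule ultrahomogeneous_extend[OF S B(1,2), of "\<lambda>b. \<theta> (e (b, i))"])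
      show "d (\<theta> (e (b, i))) (\<theta> (e (c, i))) = d b c" if "b \<in> B" "c \<in> B" for b c
      proof -
        have "d b c \<le> 1" using urysohn_sphereD(5)[OF S] B(2) that by blast
        then show ?thesis using \<theta>d[OF that] by (simp add: \<delta>_def)
      qed
    qed (use \<theta>S in auto)
    then show ?thesis by blast
  qed
  obtain g h where g: "g \<in> iso_set S d" "\<forall>b\<in>B. g b = \<theta> (e (b, False))"
    and h: "h \<in> iso_set S d" "\<forall>b\<in>B. h b = \<theta> (e (b, True))"
    using ex[of False] ex[of True] by blast
  show ?thesis
  proof (rule that[OF g(1) h(1)])
    show "g x = u" "h x = v" using g(2) h(2) B(3) \<theta>(2) p by auto
    show "\<forall>a\<in>A. d (h a) (g a) = d u v"
    proof
      fix a assume "a \<in> A"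
      then have a: "a \<in> B" "a \<in> S" using A by (auto simp: B_def)
      then show "d (h a) (g a) = d u v"
        using g(2) h(2) \<theta>d[OF a(1) a(1)] t a by (simp add: \<delta>_def t_def)
    qed
  qed
qed

text \<open>An entourage compares \<open>g\<close> and \<open>h\<close> only on a finite set. A
  close pair \<open>u\<close>, \<open>v\<close> is realised as \<open>g x\<close>,
  \<open>h x\<close> with that whole set displaced by just \<open>d u v\<close>, so the bound along
  the orbit map becomes a metric modulus for \<open>f\<close>.\<close>

lemma orbit_map_uniformly_continuous_imp:
  fixes f :: "'a \<Rightarrow> real"
  assumes S: "urysohn_sphere S d" and x: "x \<in> S" and "0 < \<eta>"
    and f: "uniformly_continuous_wrt (left_uniformity (iso_group S d) (iso_topology S d)) (\<lambda>g. f (g x))"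
  obtains \<delta> where "0 < \<delta>" "\<forall>u\<in>S. \<forall>v\<in>S. d u v < \<delta> \<longrightarrow> \<bar>f u - f v\<bar> < \<eta>"
proof -
  interpret Metric_space S d using urysohn_sphereD(1)[OF S] .
  have "eventually (\<lambda>(g, h). \<bar>f (g x) - f (h x)\<bar> < \<eta>) (left_uniformity (iso_group S d) (iso_topology S d))"
    using f \<open>0 < \<eta>\<close> by (simp add: uniformly_continuous_wrt_real_iff)
  then obtain A \<epsilon> where A: "finite A" "A \<subseteq> S" "0 < \<epsilon>"
    and near: "\<And>g h. g \<in> iso_set S d \<Longrightarrow> h \<in> iso_near S d g A \<epsilon> \<Longrightarrow> \<bar>f (g x) - f (h x)\<bar> < \<eta>"
    unfolding eventually_left_uniformity_iso by auto
  have close: "\<bar>f u - f v\<bar> < \<eta>" if uv: "u \<in> S" "v \<in> S" "d u v < \<epsilon>" for u v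
  proof -
    obtain g h where gh: "g \<in> iso_set S d" "h \<in> iso_set S d" "g x = u" "h x = v" "\<forall>a\<in>A. d (h a) (g a) = d u v"
      by (rule displaced_isometries[OF S A(1,2) x uv(1,2)])
    then have "h \<in> iso_near S d g A \<epsilon>" using uv(3) by (simp add: iso_near_def)
    from near[OF gh(1) this] show ?thesis unfolding gh(3,4) .
  qed
  show ?thesis by (rule that[OF A(3)]) (use close in blast)
qed

text \<open>Colour by the interval of length \<open>\<eta>\<close> containing the value of
  \<open>f\<close>. On the thickening by \<open>\<delta> / 2\<close> the values leave the interval
  by at most \<open>\<eta>\<close> on either side, whence \<open>3 * \<eta>\<close>.\<close>

lemma small_oscillation_copy:
  fixes f :: "'a \<Rightarrow> real"
  assumes S: "urysohn_sphere S d" and bdd: "\<And>s. s \<in> S \<Longrightarrow> \<bar>f s\<bar> \<le> B" and \<eta>: "0 < \<eta>"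
    and uc: "0 < \<delta>" "\<forall>u\<in>S. \<forall>v\<in>S. d u v < \<delta> \<longrightarrow> \<bar>f u - f v\<bar> < \<eta>"
  obtains \<phi> where "isometric_embedding S d S d \<phi>" "\<forall>s\<in>S. \<forall>t\<in>S. \<bar>f (\<phi> s) - f (\<phi> t)\<bar> \<le> 3 * \<eta>"
proof -
  \<comment> \<open>Adding \<open>B\<close> makes the values nonnegative, so \<open>nat\<close>
    loses nothing.\<close>
  define c where "c s = nat \<lfloor>(f s + B) / \<eta>\<rfloor>" for s
  define k where "k = nat \<lfloor>2 * B / \<eta>\<rfloor> + 1"
  have ck: "c s < k" if "s \<in> S" for s
  proof -
    have "(f s + B) / \<eta> \<le> 2 * B / \<eta>" using bdd[OF that] \<eta> by (intro divide_right_mono) auto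
    then show ?thesis unfolding c_def k_def by (simp add: less_Suc_eq_le nat_mono floor_mono)
  qed
  have cf: "real (c s) * \<eta> \<le> f s + B" "f s + B < (real (c s) + 1) * \<eta>" if "s \<in> S" for s
  proof -
    have nn: "0 \<le> (f s + B) / \<eta>" using bdd[OF that] \<eta> by simp
    then have "real (c s) = of_int \<lfloor>(f s + B) / \<eta>\<rfloor>" by (simp add: c_def)
    then have "real (c s) \<le> (f s + B) / \<eta>" "(f s + B) / \<eta> < real (c s) + 1" by linarith+
    then show "real (c s) * \<eta> \<le> f s + B" "f s + B < (real (c s) + 1) * \<eta>"
      using \<eta> by (simp_all add: field_simps)
  qed
  have "eps_indivisible S d (\<delta> / 2)"
    using urysohn_sphere_approximately_indivisible[OF S] uc(1) by (simp add: approximately_indivisible_def)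
  moreover have "1 \<le> k \<and> c \<in> S \<rightarrow> {..<k}" using ck by (auto simp: k_def)
  ultimately have "\<exists>i<k. \<exists>N\<subseteq>S. isometric S d N d \<and> N \<subseteq> thickening S d (\<delta> / 2) {x \<in> S. c x = i}"
    unfolding eps_indivisible_def by (elim allE[of _ k] allE[of _ c] impE)
  then obtain i N where iN: "N \<subseteq> S" "isometric S d N d" "N \<subseteq> thickening S d (\<delta> / 2) {x \<in> S. c x = i}"
    by auto
  obtain \<phi> where \<phi>: "isometry_onto S d N d \<phi>" using iN(2) by (auto simp: isometric_def)
  have eq: "(real i + 1) * \<eta> = real i * \<eta> + \<eta>" by (simp add: algebra_simps)
  have bound: "real i * \<eta> - \<eta> \<le> f y + B \<and> f y + B \<le> (real i + 1) * \<eta> + \<eta>" if "y \<in> N" for y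
  proof -
    have "y \<in> thickening S d (\<delta> / 2) {x \<in> S. c x = i}" using that iN(3) by blast
    then obtain z where z: "y \<in> S" "z \<in> S" "c z = i" "d y z \<le> \<delta> / 2" by (auto simp: thickening_def)
    then have "\<bar>f y - f z\<bar> < \<eta>" using uc by auto
    then show ?thesis using cf[OF z(2), unfolded z(3)] eq by linarith
  qed
  show ?thesis
  proof (rule that)
    show "isometric_embedding S d S d \<phi>"
      using \<phi> iN(1) by (auto simp: isometry_onto_def isometric_embedding_def)
    have N: "\<phi> s \<in> N" if "s \<in> S" for s using \<phi> that by (auto simp: isometry_onto_def)
    show "\<forall>s\<in>S. \<forall>t\<in>S. \<bar>f (\<phi> s) - f (\<phi> t)\<bar> \<le> 3 * \<eta>"
    proof (intro ballI)
      fix s t assume "s \<in> S" "t \<in> S"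
      then show "\<bar>f (\<phi> s) - f (\<phi> t)\<bar> \<le> 3 * \<eta>"
        using bound[OF N, of s] bound[OF N, of t] eq by linarith
    qed
  qed
qed

lemma oscillation_stable_orbit_map:
  fixes f :: "'a \<Rightarrow> real"
  assumes S: "urysohn_sphere S d" and bdd: "bounded (f ` S)" and x: "x \<in> S"
    and uc: "uniformly_continuous_wrt (left_uniformity (iso_group S d) (iso_topology S d)) (\<lambda>g. f (g x))"
  shows "oscillation_stable (iso_group S d) (iso_topology S d) (\<lambda>g. f (g x))"
proof -
  interpret Metric_space S d using urysohn_sphereD(1)[OF S] .
  let ?G = "iso_group S d" and ?T = "iso_topology S d"
  let ?U = "left_uniformity ?G ?T"
  let ?emb = "\<lambda>\<phi>. isometric_embedding S d S d \<phi>"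
  note unif = orbit_map_uniformly_continuous_imp[OF S x _ uc]
  have embS: "\<phi> s \<in> S" if "?emb \<phi>" "s \<in> S" for \<phi> s using that by (auto simp: isometric_embedding_def)
  \<comment> \<open>The extension evaluates at \<open>x\<close> an embedding representing
    \<open>F\<close>; all representatives agree there.\<close>
  define h where "h F = f ((SOME \<phi>. ?emb \<phi> \<and> F = iso_nhds S d \<phi>) x)" for F
  have h: "h (iso_nhds S d \<phi>) = f (\<phi> x)" if \<phi>: "?emb \<phi>" for \<phi>
  proof -
    let ?\<psi> = "SOME \<psi>. ?emb \<psi> \<and> iso_nhds S d \<phi> = iso_nhds S d \<psi>"
    have \<psi>: "?emb ?\<psi> \<and> iso_nhds S d \<phi> = iso_nhds S d ?\<psi>" by (rule someI[of _ \<phi>]) (use \<phi> in simp)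
    have "?\<psi> x = \<phi> x"
      by (rule iso_nhds_unique[OF iso_nhds_not_bot[OF S \<phi>] _ order_refl _ \<phi> x]) (use \<psi> in auto)
    then show ?thesis by (simp add: h_def)
  qed
  have iso_emb: "?emb g" if "g \<in> iso_set S d" for g
    using iso_setD[OF that] by (auto simp: isometric_embedding_def)
  have "uniformly_continuous_wrt (completion_uniformity (carrier ?G) ?U) h"
    unfolding uniformly_continuous_wrt_real_iff
  proof (intro allI impI)
    fix \<eta> :: real assume \<eta>: "0 < \<eta>"
    \<comment> \<open>Three gaps of \<open>\<eta> / 4\<close>: from either embedding to a nearby
      group element, and between the two group elements.\<close>
    define P where "P = (\<lambda>(g, g'). \<bar>f (g x) - f (g' x)\<bar> < \<eta> / 4)"
    have P: "eventually P ?U"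
      unfolding P_def by (rule uc[unfolded uniformly_continuous_wrt_real_iff, rule_format]) (use \<eta> in simp)
    obtain \<delta> where \<delta>: "0 < \<delta>" "\<forall>u\<in>S. \<forall>v\<in>S. d u v < \<delta> \<longrightarrow> \<bar>f u - f v\<bar> < \<eta> / 4"
      by (rule unif[of "\<eta> / 4"]) (use \<eta> in auto)
    have close: "eventually (\<lambda>g. \<bar>f (g x) - f (\<phi> x)\<bar> < \<eta> / 4) (iso_nhds S d \<phi>)" if \<phi>: "?emb \<phi>" for \<phi>
    proof (rule eventually_mono[OF iso_nhds_near[of "{x}" S \<delta>]])
      fix g assume g: "g \<in> iso_near S d \<phi> {x} \<delta>"
      then have "g x \<in> S" using iso_setD(1)[of g x] x by (simp add: iso_near_def)
      then show "\<bar>f (g x) - f (\<phi> x)\<bar> < \<eta> / 4" using \<delta>(2) embS[OF \<phi> x] g by (simp add: iso_near_def)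
    qed (use x \<delta> in auto)
    have "\<bar>h F - h F'\<bar> < \<eta>"
      if FF: "F \<in> completion (carrier ?G) ?U" "F' \<in> completion (carrier ?G) ?U" "eventually P (F \<times>\<^sub>F F')" for F F'
    proof -
      obtain \<phi> \<psi> where \<phi>: "?emb \<phi>" "F = iso_nhds S d \<phi>" and \<psi>: "?emb \<psi>" "F' = iso_nhds S d \<psi>"
        using FF(1,2) left_completion_iso[OF S] unfolding left_completion_def by blast
      obtain P1 P2 where P12: "eventually P1 F" "eventually P2 F'" "\<And>g g'. P1 g \<Longrightarrow> P2 g' \<Longrightarrow> P (g, g')"
        using FF(3) unfolding eventually_prod_filter by blast
      have "eventually (\<lambda>g. P1 g \<and> \<bar>f (g x) - f (\<phi> x)\<bar> < \<eta> / 4) F"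
        using P12(1) close[OF \<phi>(1)] unfolding \<phi>(2) by (rule eventually_conj)
      then obtain g where g: "P1 g" "\<bar>f (g x) - f (\<phi> x)\<bar> < \<eta> / 4"
        using eventually_happens'[OF iso_nhds_not_bot[OF S \<phi>(1)]] \<phi>(2) by blast
      have "eventually (\<lambda>g. P2 g \<and> \<bar>f (g x) - f (\<psi> x)\<bar> < \<eta> / 4) F'"
        using P12(2) close[OF \<psi>(1)] unfolding \<psi>(2) by (rule eventually_conj)
      then obtain g' where g': "P2 g'" "\<bar>f (g' x) - f (\<psi> x)\<bar> < \<eta> / 4"
        using eventually_happens'[OF iso_nhds_not_bot[OF S \<psi>(1)]] \<psi>(2) by blast
      have "\<bar>f (g x) - f (g' x)\<bar> < \<eta> / 4" using P12(3)[OF g(1) g'(1)] by (simp add: P_def)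
      then show ?thesis unfolding \<phi>(2) \<psi>(2) h[OF \<phi>(1)] h[OF \<psi>(1)] using g(2) g'(2) \<eta> by linarith
    qed
    then have "eventually (\<lambda>(F, F'). \<bar>h F - h F'\<bar> < \<eta>)
        (principal {(F, F') \<in> completion (carrier ?G) ?U \<times> completion (carrier ?G) ?U. eventually P (F \<times>\<^sub>F F')})"
      unfolding eventually_principal by auto
    moreover have "completion_uniformity (carrier ?G) ?U
        \<le> principal {(F, F') \<in> completion (carrier ?G) ?U \<times> completion (carrier ?G) ?U. eventually P (F \<times>\<^sub>F F')}"
      unfolding completion_uniformity_def by (rule INF_lower) (use P in simp)
    ultimately show "eventually (\<lambda>(F, F'). \<bar>h F - h F'\<bar> < \<eta>) (completion_uniformity (carrier ?G) ?U)"
      by (meson filter_leD)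
  qed
  moreover have "\<forall>g\<in>carrier ?G. h (completion_embed ?U g) = f (g x)"
    using completion_embed_iso h iso_emb by (simp add: carrier_iso_group)
  moreover have "\<exists>I. right_ideal_left_completion ?G ?T I \<and> (SUP (a, b)\<in>I \<times> I. ereal \<bar>h a - h b\<bar>) < ereal \<epsilon>"
    if \<epsilon>: "0 < \<epsilon>" for \<epsilon>
  proof -
    obtain B where B: "\<And>s. s \<in> S \<Longrightarrow> \<bar>f s\<bar> \<le> B" using bdd by (auto simp: bounded_iff)
    \<comment> \<open>The copy triples the tolerance, so the oscillation is at most
      \<open>\<epsilon> / 2\<close> and the supremum stays strictly below
      \<open>\<epsilon>\<close>.\<close>
    have \<epsilon>6: "0 < \<epsilon> / 6" using \<epsilon> by simp
    obtain \<delta> where \<delta>: "0 < \<delta>" "\<forall>u\<in>S. \<forall>v\<in>S. d u v < \<delta> \<longrightarrow> \<bar>f u - f v\<bar> < \<epsilon> / 6"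
      by (rule unif[OF \<epsilon>6])
    obtain a where a: "?emb a" "\<forall>s\<in>S. \<forall>t\<in>S. \<bar>f (a s) - f (a t)\<bar> \<le> 3 * (\<epsilon> / 6)"
      by (rule small_oscillation_copy[OF S B \<epsilon>6 \<delta>])
    define I where "I = {iso_nhds S d \<phi> | \<phi>. ?emb \<phi> \<and> \<phi> ` S \<subseteq> a ` S}"
    have "right_ideal_left_completion ?G ?T I"
      unfolding right_ideal_left_completion_def left_completion_iso[OF S]
    proof (intro conjI ballI)
      show "I \<noteq> {}" using a(1) by (auto simp: I_def)
      show "I \<subseteq> {iso_nhds S d \<phi> | \<phi>. ?emb \<phi>}" by (auto simp: I_def)
      fix F F' assume "F \<in> I" "F' \<in> {iso_nhds S d \<phi> | \<phi>. ?emb \<phi>}"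
      then obtain \<phi> \<psi> where \<phi>: "?emb \<phi>" "\<phi> ` S \<subseteq> a ` S" "F = iso_nhds S d \<phi>"
        and \<psi>: "?emb \<psi>" "F' = iso_nhds S d \<psi>" by (auto simp: I_def)
      \<comment> \<open>Right multiplication is precomposition, which can only shrink the
        image.\<close>
      have "?emb (\<phi> \<circ> \<psi>)" using \<phi>(1) \<psi>(1) embS[OF \<psi>(1)] by (auto simp: isometric_embedding_def)
      moreover have "(\<phi> \<circ> \<psi>) ` S \<subseteq> a ` S" using \<phi>(2) embS[OF \<psi>(1)] by auto
      ultimately show "left_completion_mult ?G ?T F F' \<in> I"
        unfolding \<phi>(3) \<psi>(2) left_completion_mult_iso[OF S \<phi>(1) \<psi>(1)] I_def by blast
    qed
    moreover have "(SUP (F, F')\<in>I \<times> I. ereal \<bar>h F - h F'\<bar>) \<le> ereal (\<epsilon> / 2)"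
    proof (rule SUP_least)
      fix q assume "q \<in> I \<times> I"
      then obtain \<phi> \<psi> where q: "q = (iso_nhds S d \<phi>, iso_nhds S d \<psi>)"
        and \<phi>: "?emb \<phi>" "\<phi> ` S \<subseteq> a ` S" and \<psi>: "?emb \<psi>" "\<psi> ` S \<subseteq> a ` S" by (auto simp: I_def)
      obtain s t where "s \<in> S" "t \<in> S" "\<phi> x = a s" "\<psi> x = a t" using \<phi>(2) \<psi>(2) x by blast
      then have "\<bar>f (\<phi> x) - f (\<psi> x)\<bar> \<le> \<epsilon> / 2" using a(2) by force
      then show "(case q of (F, F') \<Rightarrow> ereal \<bar>h F - h F'\<bar>) \<le> ereal (\<epsilon> / 2)"
        by (simp add: q h[OF \<phi>(1)] h[OF \<psi>(1)])
    qed
    then have "(SUP (F, F')\<in>I \<times> I. ereal \<bar>h F - h F'\<bar>) < ereal \<epsilon>"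
      by (rule le_less_trans) (use \<epsilon> in simp)
    ultimately show ?thesis by blast
  qed
  ultimately show ?thesis unfolding oscillation_stable_def using uc by blast
qed

theorem theorem69:
  fixes S :: "'a set" and d :: "'a \<Rightarrow> 'a \<Rightarrow> real"
  assumes "urysohn_sphere S d"
  shows "approximately_indivisible S d \<and>
         oscillation_stable_action (iso_group S d) (iso_topology S d)
           (Metric_space.mtopology S d) (\<lambda>g x. g x)"
proof (intro conjI urysohn_sphere_approximately_indivisible[OF assms])
  interpret Metric_space S d using urysohn_sphereD(1)[OF assms] .
  show "oscillation_stable_action (iso_group S d) (iso_topology S d) mtopology (\<lambda>g x. g x)"
    unfolding oscillation_stable_action_def
    using topological_group_iso continuous_action_iso oscillation_stable_orbit_map[OF assms] by simp
qed

end
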